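(* Let $F=f_1+f_2+h$, where $\nabla f_1$ is Lipschitz continuous on $\mathbb R^n$ with constant $L_{f_1}>0$, $\nabla h$ is Lipschitz continuous on $\mathbb R^n$ with constant $L_h>0$, $f_2:\mathbb R^n\to\mathbb R\cup\{\infty\}$ is proper and closed (lower semicontinuous), and $F$ is bounded from below. Let $l\in\mathbb R$ be a constant such that $f_1+\frac l2\|\cdot\|^2$ is convex, and let $\alpha,\gamma$ satisfy $0<\gamma<\frac1{L_{f_1}+L_h}$ and $0\le\alpha<\Lambda(\gamma)$, where $\Lambda(\gamma)=\frac{1-\gamma l-2\gamma L_h}{2+\gamma L_h}-\gamma^2L_{f_1}^2$. Assume in addition that $h$ is twice continuously differentiable with bounded Hessian, i.e., there exists a constant $M>0$ such that $\|\nabla^2 h(\mathbf y)\|\le M$ for all $\mathbf y\in\mathbb R^n$. Let $\{(\mathbf y^k,\mathbf z^k,\mathbf x^k)\}_{k\ge 1}$ be a sequence generated by the extrapolated DYS iteration described in the context, assumed to be bounded, and let $\mathbf u^k=(\mathbf y^k,\mathbf z^k,\mathbf x^k,\mathbf x^{k-1},\mathbf x^{k-2})$ for $k\ge1$. If $F$ is a KL function, then the sequence $\{\mathbf u^k\}_{k\ge1}$ has finite length, that is, $$\sum_{k=1}^\infty\|\mathbf y^{k+1}-\mathbf y^k\|<+\infty,\qquad \sum_{k=1}^\infty\|\mathbf z^{k+1}-\mathbf z^k\|<+\infty,\qquad \sum_{k=1}^\infty\|\mathbf x^{k+1}-\mathbf x^k\|<+\infty.$$ Hence the whole sequence $\{\mathbf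 u^k\}_{k\ge1}$ is convergent.
   Context: The problem is $\min_{\mathbf x\in\mathbb R^n}F(\mathbf x)=f_1(\mathbf x)+f_2(\mathbf x)+h(\mathbf x)$, where $f_1,h:\mathbb R^n\to\mathbb R$ are continuously differentiable (possibly nonconvex) and $f_2$ is an extended-real-valued (possibly nonconvex) function. Standing assumptions: (i) $\nabla f_1$ is Lipschitz continuous on $\mathbb R^n$ with constant $L_{f_1}>0$; (ii) $\nabla h$ is Lipschitz continuous on $\mathbb R^n$ with constant $L_h>0$; (iii) $f_2:\mathbb R^n\to\mathbb R\cup\{\infty\}$ is proper and closed (lower semicontinuous), and $F$ is bounded from below. Let $l\in\mathbb R$ be a constant such that $f_1+\frac l2\|\cdot\|^2$ is convex (e.g. $l=L_{f_1}$ is always possible). Define $\Lambda(\gamma)=\frac{1-\gamma l-2\gamma L_h}{2+\gamma L_h}-\gamma^2L_{f_1}^2$. Parameter condition: $0<\gamma<\frac1{L_{f_1}+L_h}$ and $0\le\alpha<\Lambda(\gamma)$. For $\gamma>0$, $\mathrm{Prox}_{\gamma f}(\mathbf x)=\arg\min_{\mathbf y\in\mathbb R^n}\{f(\mathbf y)+\frac1{2\gamma}\|\mathbf y-\mathbf x\|^2\}$ (possibly set-valued, in which case any element may be chosen). Extrapolated DYS iteration: given $\mathbf x^0$ and $\mathbf x^{-1}=\mathbf x^0$, for $k=0,1,2,\dots$, $$\mathbf w^k=\mathbf x^k+\alpha(\mathbf x^k-\mathbf x^{k-1}),\quad \mathbf y^{k+1}\in\mathrm{Prox}_{\gamma f_1}(\mathbf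 w^k),\quad \mathbf z^{k+1}\in\mathrm{Prox}_{\gamma f_2}(2\mathbf y^{k+1}-\gamma\nabla h(\mathbf y^{k+1})-\mathbf w^k),\quad \mathbf x^{k+1}=\mathbf w^k+(\mathbf z^{k+1}-\mathbf y^{k+1}).$$ Limiting subdifferential: $\widehat\partial f(\mathbf x)$ (for $\mathbf x\in\mathrm{dom} f$) is the set of $\mathbf u$ with $\liminf_{\mathbf y\ne\mathbf x,\mathbf y\to\mathbf x}\frac{f(\mathbf y)-f(\mathbf x)-\langle\mathbf u,\mathbf y-\mathbf x\rangle}{\|\mathbf y-\mathbf x\|}\ge0$ (empty if $\mathbf x\notin\mathrm{dom} f$), and $\partial f(\mathbf x)=\{\mathbf u: \exists\,\mathbf x^k\to\mathbf x,\ f(\mathbf x^k)\to f(\mathbf x),\ \mathbf u^k\in\widehat\partial f(\mathbf x^k),\ \mathbf u^k\to\mathbf u\}$. $\mathrm{dist}(\mathbf x,S)=\inf_{\mathbf y\in S}\|\mathbf y-\mathbf x\|$, equal to $\infty$ if $S=\emptyset$. KL function: a proper lower semicontinuous $f:\mathbb R^n\to(-\infty,+\infty]$ has the KL property at $\mathbf x^*\in\mathrm{dom}(\partial f)$ if there exist $\eta\in(0,+\infty]$, a neighborhood $U$ of $\mathbf x^*$, and a continuous concave $\varphi:[0,\eta)\to\mathbb R_+$ with $\varphi(0)=0$, $\varphi$ continuously differentiable on $(0,\eta)$ with $\varphi'>0$, such that $\varphi'(f(\mathbf x)-f(\mathbf x^* ))\,\mathrm{dist}(0,\partial f(\mathbf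 x))\ge1$ for all $\mathbf x\in U$ with $f(\mathbf x^* )<f(\mathbf x)<f(\mathbf x^* )+\eta$. $f$ is a KL function if it has the KL property at each point of $\mathrm{dom}(\partial f)$. *)

theory Defs
  imports "HOL-Analysis.Analysis"
begin

text \<open>
  Functions with values in \<open>(-\<infinity>, \<infinity>]\<close> are rendered as functions into \<open>ereal\<close>;
  \<open>proper_fun\<close> excludes the value \<open>-\<infinity>\<close>.
\<close>

definition proper_fun :: "('a \<Rightarrow> ereal) \<Rightarrow> bool" where
  "proper_fun f \<longleftrightarrow> (\<forall>x. f x \<noteq> - \<infinity>) \<and> (\<exists>x. f x < \<infinity>)"

definition lower_semicont :: "('a::topological_space \<Rightarrow> ereal) \<Rightarrow> bool" where
  "lower_semicont f \<longleftrightarrow> (\<forall>x. f x \<le> Liminf (at x) f)"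

definition dom_fun :: "('a \<Rightarrow> ereal) \<Rightarrow> 'a set" where
  "dom_fun f = {x. f x < \<infinity>}"

definition frechet_subdiff :: "('a::euclidean_space \<Rightarrow> ereal) \<Rightarrow> 'a \<Rightarrow> 'a set" where
  "frechet_subdiff f x =
     {u. x \<in> dom_fun f \<and>
         0 \<le> Liminf (at x) (\<lambda>y. (f y - f x - ereal (u \<bullet> (y - x))) / ereal (norm (y - x)))}"

text \<open>
  The condition \<open>x \<in> dom_fun f\<close> makes \<open>f (xs k) \<longlonglongrightarrow> f x\<close> a convergence of real
  values; without it the order topology of \<open>ereal\<close> would also admit \<open>f x = \<infinity>\<close>.
\<close>

definition limiting_subdiff :: "('a::euclidean_space \<Rightarrow> ereal) \<Rightarrow> 'a \<Rightarrow> 'a set" where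
  "limiting_subdiff f x =
     {u. x \<in> dom_fun f \<and>
         (\<exists>xs us. xs \<longlonglongrightarrow> x \<and> (\<lambda>k. f (xs k)) \<longlonglongrightarrow> f x \<and>
            (\<forall>k::nat. us k \<in> frechet_subdiff f (xs k)) \<and> us \<longlonglongrightarrow> u)}"

definition dom_subdiff :: "('a::euclidean_space \<Rightarrow> ereal) \<Rightarrow> 'a set" where
  "dom_subdiff f = {x. limiting_subdiff f x \<noteq> {}}"

text \<open>Unlike \<open>infdist\<close>, this distance is \<open>\<infinity>\<close> for the empty set.\<close>

definition dist_set :: "'a::real_normed_vector \<Rightarrow> 'a set \<Rightarrow> ereal" where
  "dist_set x S = (INF y\<in>S. ereal (norm (y - x)))"

definition KL_property_at :: "('a::euclidean_space \<Rightarrow> ereal) \<Rightarrow> 'a \<Rightarrow> bool" where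
  "KL_property_at f xstar \<longleftrightarrow>
     (\<exists>(\<eta>::ereal) U \<phi> \<phi>'.
        0 < \<eta> \<and> open U \<and> xstar \<in> U \<and>
        continuous_on {t. 0 \<le> t \<and> ereal t < \<eta>} \<phi> \<and>
        concave_on {t. 0 \<le> t \<and> ereal t < \<eta>} \<phi> \<and>
        (\<forall>t. 0 \<le> t \<and> ereal t < \<eta> \<longrightarrow> 0 \<le> \<phi> t) \<and>
        \<phi> 0 = 0 \<and>
        (\<forall>t. 0 < t \<and> ereal t < \<eta> \<longrightarrow> (\<phi> has_real_derivative \<phi>' t) (at t) \<and> 0 < \<phi>' t) \<and>
        continuous_on {t. 0 < t \<and> ereal t < \<eta>} \<phi>' \<and>
        (\<forall>x\<in>U. f xstar < f x \<and> f x < f xstar + \<eta> \<longrightarrow>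
           1 \<le> ereal (\<phi>' (real_of_ereal (f x - f xstar))) * dist_set 0 (limiting_subdiff f x)))"

definition KL_function :: "('a::euclidean_space \<Rightarrow> ereal) \<Rightarrow> bool" where
  "KL_function f \<longleftrightarrow>
     proper_fun f \<and> lower_semicont f \<and> (\<forall>x\<in>dom_subdiff f. KL_property_at f x)"

definition Prox :: "real \<Rightarrow> ('a::euclidean_space \<Rightarrow> ereal) \<Rightarrow> 'a \<Rightarrow> 'a set" where
  "Prox \<gamma> f x =
     {y. is_arg_min (\<lambda>v. f v + ereal (1 / (2 * \<gamma>) * (norm (v - x))\<^sup>2)) (\<lambda>_. True) y}"

definition DYS_Lambda :: "real \<Rightarrow> real \<Rightarrow> real \<Rightarrow> real \<Rightarrow> real" where
  "DYS_Lambda l Lf1 Lh \<gamma> =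
     (1 - \<gamma> * l - 2 * \<gamma> * Lh) / (2 + \<gamma> * Lh) - \<gamma>\<^sup>2 * Lf1\<^sup>2"

definition objective ::
  "('a \<Rightarrow> real) \<Rightarrow> ('a \<Rightarrow> ereal) \<Rightarrow> ('a \<Rightarrow> real) \<Rightarrow> 'a \<Rightarrow> ereal" where
  "objective f1 f2 h x = ereal (f1 x) + f2 x + ereal (h x)"

text \<open>
  Here \<open>dh\<close> is the gradient of \<open>h\<close>. The convention \<open>x\<^sup>-\<^sup>1 = x\<^sup>0\<close> is encoded by
  truncated subtraction: \<open>x (k - 1)\<close> is \<open>x 0\<close> for \<open>k = 0\<close>, and likewise \<open>x (k - 2)\<close> is
  \<open>x\<^sup>-\<^sup>1 = x 0\<close> for \<open>k = 1\<close>. The values \<open>y 0\<close> and \<open>z 0\<close> are not part of the iteration.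
\<close>

definition extrapolated_DYS ::
  "real \<Rightarrow> real \<Rightarrow> ('a::euclidean_space \<Rightarrow> real) \<Rightarrow> ('a \<Rightarrow> ereal) \<Rightarrow> ('a \<Rightarrow> 'a) \<Rightarrow>
   (nat \<Rightarrow> 'a) \<Rightarrow> (nat \<Rightarrow> 'a) \<Rightarrow> (nat \<Rightarrow> 'a) \<Rightarrow> (nat \<Rightarrow> 'a) \<Rightarrow> bool" where
  "extrapolated_DYS \<alpha> \<gamma> f1 f2 dh w y z x \<longleftrightarrow>
     (\<forall>k. w k = x k + \<alpha> *\<^sub>R (x k - x (k - 1)) \<and>
          y (k + 1) \<in> Prox \<gamma> (\<lambda>v. ereal (f1 v)) (w k) \<and>
          z (k + 1) \<in> Prox \<gamma> f2 (2 *\<^sub>R y (k + 1) - \<gamma> *\<^sub>R dh (y (k + 1)) - w k) \<and>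
          x (k + 1) = w k + (z (k + 1) - y (k + 1)))"

definition DYS_tuple ::
  "(nat \<Rightarrow> 'a) \<Rightarrow> (nat \<Rightarrow> 'a) \<Rightarrow> (nat \<Rightarrow> 'a) \<Rightarrow> nat \<Rightarrow> 'a \<times> 'a \<times> 'a \<times> 'a \<times> 'a" where
  "DYS_tuple y z x k = (y k, z k, x k, x (k - 1), x (k - 2))"

end

theory Submission
  imports Defs
begin

text \<open>
  Optimality for \<open>f1\<close> gives \<open>w = y + \<gamma> \<nabla>f1 y\<close>, so \<open>z\<close> is a forward-backward step for
  \<open>g = f1 + h\<close> and \<open>f2\<close> from \<open>y\<close>. The forward-backward envelope at \<open>y\<close> plus a multiple of
  the squared last increment of \<open>x\<close> is a merit value that decreases by a multiple of the squared
  increment of \<open>y\<close>. The KL property is available for \<open>F\<close> only, not for the merit function; but \<open>F z\<close> lies below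
  the merit value by at most a quadratic expression in the increments, and this error is absorbed by
  adding a square root to the desingularizing function. The KL inequality made uniform on the cluster
  set of \<open>z\<close> then bounds the squared increment of \<open>y\<close> by a telescoping factor times the increments.
  Since the increments of \<open>x\<close> contract up to those of \<open>y\<close>, both are summable.
\<close>

subsection \<open>Gradients, proximal points and subgradients\<close>

lemma GDERIV_along_line:
  fixes f :: "'a::real_inner \<Rightarrow> real"
  assumes "GDERIV f (u + t *\<^sub>R d) :> D"
  shows "((\<lambda>t. f (u + t *\<^sub>R d)) has_real_derivative (D \<bullet> d)) (at t)"
proof -
  have "((\<lambda>t. u + t *\<^sub>R d) has_derivative (\<lambda>s. s *\<^sub>R d)) (at t)"
    by (auto intro!: derivative_eq_intros)
  from has_derivative_compose[OF this assms[unfolded gderiv_def]]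
  show ?thesis
    by (simp add: has_field_derivative_def mult_commute_abs inner_commute[of D])
qed

text \<open>The descent lemma: along the segment, \<open>f\<close> minus its linearization at
  \<open>u\<close> and the quadratic term has nonpositive derivative, because \<open>df\<close>
  moves by at most \<open>L * t * norm d\<close>.\<close>

lemma lipschitz_gradient_upper:
  fixes f :: "'a::real_inner \<Rightarrow> real"
  assumes grad: "\<And>v. GDERIV f v :> df v" and lip: "L-lipschitz_on UNIV df"
  shows "f v \<le> f u + df u \<bullet> (v - u) + L / 2 * (norm (v - u))\<^sup>2"
proof -
  define d where "d = v - u"
  let ?\<psi> = "\<lambda>t. f (u + t *\<^sub>R d) - t * (df u \<bullet> d) - L / 2 * t\<^sup>2 * (norm d)\<^sup>2"
  have "?\<psi> 1 \<le> ?\<psi> 0"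
  proof (rule DERIV_nonpos_imp_nonincreasing[of 0 1 ?\<psi>])
    fix t :: real assume t: "0 \<le> t" "t \<le> 1"
    have "(?\<psi> has_real_derivative
        (df (u + t *\<^sub>R d) \<bullet> d - df u \<bullet> d - L * t * (norm d)\<^sup>2)) (at t)"
      by (auto intro!: derivative_eq_intros GDERIV_along_line grad)
    moreover have "df (u + t *\<^sub>R d) \<bullet> d - df u \<bullet> d \<le> L * t * (norm d)\<^sup>2"
    proof -
      have "(df (u + t *\<^sub>R d) - df u) \<bullet> d \<le> norm (df (u + t *\<^sub>R d) - df u) * norm d"
        by (rule norm_cauchy_schwarz)
      also have "\<dots> \<le> (L * norm (t *\<^sub>R d)) * norm d"
        using lipschitz_onD[OF lip, of "u + t *\<^sub>R d" u]
        by (intro mult_right_mono) (auto simp: dist_norm)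
      finally show ?thesis
        using t by (simp add: inner_diff_left power2_eq_square mult.assoc)
    qed
    ultimately show "\<exists>D. (?\<psi> has_real_derivative D) (at t) \<and> D \<le> 0"
      by (intro exI[of _ "df (u + t *\<^sub>R d) \<bullet> d - df u \<bullet> d - L * t * (norm d)\<^sup>2"]) auto
  qed simp
  then show ?thesis
    by (simp add: d_def)
qed

lemma lipschitz_gradient_lower:
  fixes f :: "'a::real_inner \<Rightarrow> real"
  assumes grad: "\<And>v. GDERIV f v :> df v" and lip: "L-lipschitz_on UNIV df"
  shows "f u + df u \<bullet> (v - u) - L / 2 * (norm (v - u))\<^sup>2 \<le> f v"
  using lipschitz_gradient_upper[OF GDERIV_minus[OF grad], of L v u] lip
  by (simp add: inner_minus_left)

lemma GDERIV_half_norm_sq: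
  "GDERIV (\<lambda>v. c / 2 * (norm (v - w))\<^sup>2) v :> c *\<^sub>R (v - w)"
  unfolding gderiv_def power2_norm_eq_inner
  by (auto intro!: derivative_eq_intros simp: inner_commute inner_diff_left inner_diff_right algebra_simps)

lemma convex_gradient_lower:
  fixes f :: "'a::real_inner \<Rightarrow> real"
  assumes grad: "GDERIV f u :> D" and conv: "convex_on UNIV f"
  shows "f u + D \<bullet> (v - u) \<le> f v"
proof -
  let ?g = "\<lambda>t. f (u + t *\<^sub>R (v - u))"
  have "convex_on UNIV ?g"
  proof (rule convex_onI)
    fix t a b :: real assume t: "0 < t" "t < 1"
    have "u + ((1 - t) *\<^sub>R a + t *\<^sub>R b) *\<^sub>R (v - u)
        = (1 - t) *\<^sub>R (u + a *\<^sub>R (v - u)) + t *\<^sub>R (u + b *\<^sub>R (v - u))"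
      by (simp add: algebra_simps)
    then show "?g ((1 - t) *\<^sub>R a + t *\<^sub>R b) \<le> (1 - t) * ?g a + t * ?g b"
      using convex_onD[OF conv, of t "u + a *\<^sub>R (v - u)" "u + b *\<^sub>R (v - u)"] t by simp
  qed simp
  moreover have "(?g has_real_derivative (D \<bullet> (v - u))) (at 0)"
    using GDERIV_along_line[of f u 0 "v - u" D] grad by simp
  ultimately have "?g 1 - ?g 0 \<ge> (D \<bullet> (v - u)) * (1 - 0)"
    by (intro convex_on_imp_above_tangent[of UNIV]) auto
  then show ?thesis by simp
qed

lemma weakly_convex_gradient_lower:
  fixes f :: "'a::real_inner \<Rightarrow> real"
  assumes grad: "GDERIV f u :> D" and conv: "convex_on UNIV (\<lambda>v. f v + l / 2 * (norm v)\<^sup>2)"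
  shows "f u + D \<bullet> (v - u) - l / 2 * (norm (v - u))\<^sup>2 \<le> f v"
proof -
  have "GDERIV (\<lambda>v. f v + l / 2 * (norm v)\<^sup>2) u :> D + l *\<^sub>R u"
    using GDERIV_add[OF grad GDERIV_half_norm_sq[of l 0 u]] by simp
  from convex_gradient_lower[OF this conv, of v]
  have *: "f u + l / 2 * (norm u)\<^sup>2 + (D + l *\<^sub>R u) \<bullet> (v - u) \<le> f v + l / 2 * (norm v)\<^sup>2" .
  have "(norm (v - u))\<^sup>2 = (norm v)\<^sup>2 - (norm u)\<^sup>2 - 2 * (u \<bullet> (v - u))"
    by (simp add: power2_norm_eq_inner inner_diff_left inner_diff_right inner_commute)
  then have "l / 2 * (norm (v - u))\<^sup>2 = l / 2 * (norm v)\<^sup>2 - l / 2 * (norm u)\<^sup>2 - l * (u \<bullet> (v - u))"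
    by (simp only:) (simp add: algebra_simps del: inner_diff_right)
  moreover have "(D + l *\<^sub>R u) \<bullet> (v - u) = D \<bullet> (v - u) + l * (u \<bullet> (v - u))"
    by (simp add: inner_add_left)
  ultimately show ?thesis
    using * by linarith
qed

text \<open>At a unit vector, the upper quadratic bound with \<open>L\<close> and the lower one with
  \<open>l\<close>, both expanded at 0, are compatible only in this range. It later yields \<alpha>
  \<le> 1.\<close>

lemma weak_convexity_modulus_ge:
  fixes f :: "'a::euclidean_space \<Rightarrow> real"
  assumes grad: "\<And>v. GDERIV f v :> df v" and lip: "L-lipschitz_on UNIV df"
    and conv: "convex_on UNIV (\<lambda>v. f v + l / 2 * (norm v)\<^sup>2)"
  shows "- L \<le> l"
proof -
  obtain b :: 'a where b: "b \<in> Basis" using nonempty_Basis by blast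
  show ?thesis
    using lipschitz_gradient_upper[OF grad lip, of b 0]
      weakly_convex_gradient_lower[OF grad conv, of 0 b] b by simp
qed

text \<open>Fermat's rule for the differentiable proximal objective; it makes \<open>w\<close> an
  explicit function of \<open>y\<close>.\<close>

lemma Prox_gradient:
  fixes f :: "'a::euclidean_space \<Rightarrow> real"
  assumes grad: "\<And>v. GDERIV f v :> df v" and y: "y \<in> Prox \<gamma> (\<lambda>v. ereal (f v)) w"
    and \<gamma>: "0 < \<gamma>"
  shows "w = y + \<gamma> *\<^sub>R df y"
proof -
  let ?p = "\<lambda>v. f v + (1 / \<gamma>) / 2 * (norm (v - w))\<^sup>2"
  have "GDERIV ?p y :> df y + (1 / \<gamma>) *\<^sub>R (y - w)"
    by (intro GDERIV_add grad GDERIV_half_norm_sq)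
  moreover have "?p y \<le> ?p v" for v
    using y by (auto simp: Prox_def is_arg_min_def not_less mult.commute)
  ultimately have "(\<lambda>h. h \<bullet> (df y + (1 / \<gamma>) *\<^sub>R (y - w))) = (\<lambda>h. 0)"
    unfolding gderiv_def by (intro has_derivative_local_min) auto
  then have "df y + (1 / \<gamma>) *\<^sub>R (y - w) = 0"
    by (metis inner_eq_zero_iff)
  then have "\<gamma> *\<^sub>R (df y + (1 / \<gamma>) *\<^sub>R (y - w)) = 0"
    by simp
  then show ?thesis
    using \<gamma> by (simp add: scaleR_add_right algebra_simps)
qed

lemma Prox_finite:
  fixes f :: "'a::euclidean_space \<Rightarrow> ereal"
  assumes proper: "proper_fun f" and z: "z \<in> Prox \<gamma> f q"
  obtains c where "f z = ereal c"
proof -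
  from proper obtain v where v: "f v < \<infinity>" by (auto simp: proper_fun_def)
  have "f z + ereal (1 / (2 * \<gamma>) * (norm (z - q))\<^sup>2) \<le> f v + ereal (1 / (2 * \<gamma>) * (norm (v - q))\<^sup>2)"
    using z by (auto simp: Prox_def is_arg_min_def not_less)
  with v have "f z \<noteq> \<infinity>" by (cases "f v") auto
  moreover have "f z \<noteq> -\<infinity>" using proper by (auto simp: proper_fun_def)
  ultimately show ?thesis using that by (cases "f z") auto
qed

text \<open>The quadratic minorant bounds the difference quotient below by
  \<open>- C * norm (y - x)\<close>, which tends to 0.\<close>

lemma proximal_subgradient_frechet:
  fixes f :: "'a::euclidean_space \<Rightarrow> ereal"
  assumes fx: "f x = ereal c" and lower: "\<And>y. ereal (c + u \<bullet> (y - x) - C * (norm (y - x))\<^sup>2) \<le> f y"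
  shows "u \<in> frechet_subdiff f x"
proof -
  have "((\<lambda>y. ereal (- C * norm (y - x))) \<longlongrightarrow> ereal (- C * norm (x - x))) (at x)"
    by (intro tendsto_intros)
  then have "Liminf (at x) (\<lambda>y. ereal (- C * norm (y - x))) = 0"
    by (subst lim_imp_Liminf) (auto simp: zero_ereal_def)
  moreover have "Liminf (at x) (\<lambda>y. ereal (- C * norm (y - x)))
      \<le> Liminf (at x) (\<lambda>y. (f y - f x - ereal (u \<bullet> (y - x))) / ereal (norm (y - x)))"
  proof (rule Liminf_mono)
    have "ereal (- C * norm (y - x)) \<le> (f y - f x - ereal (u \<bullet> (y - x))) / ereal (norm (y - x))"
      if "y \<noteq> x" for y
    proof (cases "f y")
      case (real r)
      have n: "0 < norm (y - x)" using that by simp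
      have "c + u \<bullet> (y - x) - C * (norm (y - x))\<^sup>2 \<le> r"
        using lower[of y] real by simp
      then have "- C * norm (y - x) * norm (y - x) \<le> r - c - u \<bullet> (y - x)"
        by (simp add: power2_eq_square mult.assoc)
      then have "- C * norm (y - x) \<le> (r - c - u \<bullet> (y - x)) / norm (y - x)"
        using n pos_le_divide_eq by blast
      then show ?thesis using that by (simp add: real fx)
    next
      case PInf
      then show ?thesis using that by (simp add: fx)
    next
      case MInf
      then show ?thesis using lower[of y] by simp
    qed
    then show "\<forall>\<^sub>F y in at x. ereal (- C * norm (y - x))
        \<le> (f y - f x - ereal (u \<bullet> (y - x))) / ereal (norm (y - x))"
      by (simp add: eventually_at_filter)
  qed
  ultimately show ?thesis
    by (simp add: frechet_subdiff_def dom_fun_def fx)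
qed

lemma frechet_subset_limiting:
  "frechet_subdiff f x \<subseteq> limiting_subdiff f x"
proof
  fix u assume u: "u \<in> frechet_subdiff f x"
  then have "x \<in> dom_fun f" by (simp add: frechet_subdiff_def)
  with u show "u \<in> limiting_subdiff f x"
    unfolding limiting_subdiff_def mem_Collect_eq
    by (intro conjI exI[of _ "\<lambda>_. x"] exI[of _ "\<lambda>_. u"]) auto
qed

lemma lower_semicont_le_lim:
  assumes lsc: "lower_semicont f" and X: "X \<longlonglongrightarrow> x" and fX: "(\<lambda>n. f (X n)) \<longlonglongrightarrow> c"
  shows "f x \<le> c"
proof (rule ccontr)
  assume "\<not> f x \<le> c"
  then obtain e where e: "c < e" "e < f x"
    using dense not_le by metis
  then have "e < Liminf (at x) f"
    using lsc by (auto simp: lower_semicont_def intro: less_le_trans)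
  then have "eventually (\<lambda>v. e < f v) (at x)" by (rule less_LiminfD)
  \<comment> \<open>\<open>Liminf\<close> at \<open>x\<close> ignores the point itself, but the
    sequence may visit it; \<open>e < f x\<close> covers that case.\<close>
  then have "eventually (\<lambda>v. e < f v) (nhds x)"
    using e by (auto simp: eventually_at_filter elim!: eventually_mono)
  then have "eventually (\<lambda>n. e < f (X n)) sequentially"
    using X by (auto simp: filterlim_iff)
  then have "e \<le> c"
    by (intro tendsto_lowerbound[OF fX]) (auto elim: eventually_mono)
  with e show False by simp
qed

subsection \<open>Recurrences with summable perturbation\<close>

text \<open>Summing the recurrence bounds each partial sum of \<open>B\<close> by a constant plus
  \<rho> times itself, and \<rho> < 1 lets it be isolated.\<close>

lemma summable_linear_recurrence:
  fixes B g :: "nat \<Rightarrow> real"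
  assumes B: "\<And>k. 0 \<le> B k" and g: "\<And>k. 0 \<le> g k" "summable g"
    and \<rho>: "0 \<le> \<rho>" "\<rho> < 1" and rec: "\<And>k. B (Suc k) \<le> \<rho> * B k + g k"
  shows "summable B"
proof (rule summableI_nonneg_bounded)
  fix n
  let ?S = "\<lambda>n. \<Sum>i<n. B i"
  have "?S n \<le> ?S (Suc n)" using B by simp
  also have "\<dots> = B 0 + (\<Sum>i<n. B (Suc i))" by (rule sum.lessThan_Suc_shift)
  also have "\<dots> \<le> B 0 + (\<Sum>i<n. \<rho> * B i + g i)"
    using rec by (intro add_left_mono sum_mono)
  also have "\<dots> \<le> B 0 + \<rho> * ?S n + suminf g"
    using sum_le_suminf[OF g(2), of "{..<n}"] g(1)
    by (simp add: sum.distrib sum_distrib_left)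
  finally show "?S n \<le> (B 0 + suminf g) / (1 - \<rho>)"
    using \<rho> by (simp add: field_simps)
qed (use B in auto)

text \<open>Convexity of the square with weights \<open>1 - \<rho>\<close> and
  \<open>\<rho>\<close>, applied to \<open>C * D k / (1 - \<rho>)\<close> and \<open>B k\<close>,
  gives a linear recurrence for the squares.\<close>

lemma summable_square_recurrence:
  fixes B D :: "nat \<Rightarrow> real"
  assumes B: "\<And>k. 0 \<le> B k" and D: "\<And>k. 0 \<le> D k" "summable (\<lambda>k. (D k)\<^sup>2)"
    and \<rho>: "0 \<le> \<rho>" "\<rho> < 1" and C: "0 \<le> C" and rec: "\<And>k. B (Suc k) \<le> C * D k + \<rho> * B k"
  shows "summable (\<lambda>k. (B k)\<^sup>2)"
proof (rule summable_linear_recurrence)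
  show "summable (\<lambda>k. C\<^sup>2 / (1 - \<rho>) * (D k)\<^sup>2)"
    using D by (intro summable_mult)
  fix k
  have "(B (Suc k))\<^sup>2 \<le> (C * D k + \<rho> * B k)\<^sup>2"
    using rec B by (intro power_mono) auto
  also have "\<dots> \<le> \<rho> * (B k)\<^sup>2 + C\<^sup>2 / (1 - \<rho>) * (D k)\<^sup>2"
  proof -
    have "(1 - \<rho>) * (\<rho> * (B k)\<^sup>2 + C\<^sup>2 / (1 - \<rho>) * (D k)\<^sup>2) - (1 - \<rho>) * (C * D k + \<rho> * B k)\<^sup>2
       = \<rho> * (C * D k - (1 - \<rho>) * B k)\<^sup>2"
      using \<rho> by (simp add: field_simps power2_eq_square)
    also have "\<dots> \<ge> 0" using \<rho> by simp
    finally have "(1 - \<rho>) * (C * D k + \<rho> * B k)\<^sup>2 \<le> (1 - \<rho>) * (\<rho> * (B k)\<^sup>2 + C\<^sup>2 / (1 - \<rho>) * (D k)\<^sup>2)"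
      by simp
    then show ?thesis using \<rho> by simp
  qed
  finally show "(B (Suc k))\<^sup>2 \<le> \<rho> * (B k)\<^sup>2 + C\<^sup>2 / (1 - \<rho>) * (D k)\<^sup>2" .
qed (use \<rho> D in auto)

text \<open>A Young-type splitting of the product bounds \<open>D k\<close> by a multiple of
  \<open>G k\<close> plus a small multiple of \<open>B k\<close>. Inserted in \<open>rec\<close>,
  this leaves a linear recurrence for \<open>B\<close> with summable perturbation.\<close>

lemma summable_product_recurrence:
  fixes B D G :: "nat \<Rightarrow> real"
  assumes B: "\<And>k. 0 \<le> B k" and D: "\<And>k. 0 \<le> D k" and G: "\<And>k. 0 \<le> G k" "summable G"
    and \<rho>: "0 \<le> \<rho>" "\<rho> < 1" and C: "0 \<le> C" and rec: "\<And>k. B (Suc k) \<le> C * D k + \<rho> * B k"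
    and prod: "\<And>k. (D k)\<^sup>2 \<le> G k * (D k + B k)"
  shows "summable D \<and> summable B"
proof -
  \<comment> \<open>Chosen so that \<open>C * e + \<rho>\<close>, the factor of the resulting
    recurrence for \<open>B\<close>, stays below 1.\<close>
  define e where "e = (1 - \<rho>) / (2 * (C + 1))"
  have e: "0 < e" using \<rho> C by (simp add: e_def)
  have bound: "D k \<le> 2 * G k + e * B k + G k / e" for k
  proof (rule ccontr)
    assume neg: "\<not> ?thesis"
    then have big: "2 * G k + e * B k + G k / e < D k" by simp
    have D0: "0 < D k"
      using big G(1)[of k] B[of k] e by (smt (verit) divide_nonneg_pos mult_nonneg_nonneg)
    have "2 * G k < D k"
      using big G(1)[of k] B[of k] e by (smt (verit) divide_nonneg_pos mult_nonneg_nonneg)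
    \<comment> \<open>If the bound fails, \<open>2 * (G k * D k)\<close> is at most
      \<open>(D k)\<^sup>2\<close> and \<open>2 * (G k * B k)\<close> is strictly less; their sum
      contradicts \<open>prod\<close>.\<close>
    then have 1: "2 * (G k * D k) \<le> (D k)\<^sup>2"
      using D0 by (simp add: power2_eq_square)
    have 2: "2 * (G k * B k) \<le> (e * B k + G k / e)\<^sup>2"
    proof -
      have "(e * B k + G k / e)\<^sup>2 = 2 * (G k * B k) + (e * B k)\<^sup>2 + (G k / e)\<^sup>2"
        using e by (simp add: power2_sum)
      then show ?thesis by simp
    qed
    have "e * B k + G k / e < D k" using big G(1)[of k] by simp
    then have 3: "(e * B k + G k / e)\<^sup>2 < (D k)\<^sup>2"
      using e B[of k] G(1)[of k] by (intro power_strict_mono) auto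
    from 1 2 3 prod[of k] show False by (simp add: distrib_left)
  qed
  have sumB: "summable B"
  proof (rule summable_linear_recurrence)
    show "summable (\<lambda>k. C * (2 * G k + G k / e))"
      using G by (intro summable_mult summable_add summable_divide)
    show "0 \<le> C * e + \<rho>" using C e \<rho> by simp
    have "C * e \<le> (C + 1) * e" using e by simp
    also have "\<dots> = (1 - \<rho>) / 2" using C by (simp add: e_def field_simps)
    finally show "C * e + \<rho> < 1" using \<rho> by simp
    show "B (Suc k) \<le> (C * e + \<rho>) * B k + C * (2 * G k + G k / e)" for k
      using rec[of k] mult_left_mono[OF bound[of k] C] by (simp add: algebra_simps)
  qed (use B C e G in auto)
  moreover have "summable D"
  proof (rule summable_comparison_test')
    show "summable (\<lambda>k. 2 * G k + e * B k + G k / e)"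
      using G sumB by (intro summable_mult summable_add summable_divide)
    show "norm (D k) \<le> 2 * G k + e * B k + G k / e" for k
      using bound[of k] D[of k] by simp
  qed
  ultimately show ?thesis by simp
qed

subsection \<open>Uniform Kurdyka--Lojasiewicz inequality\<close>

text \<open>
  The tangent inequality is all that the argument needs from a concave desingularizing
  function, and it is stable under sums and rescaling.
\<close>

definition desingularizing :: "real \<Rightarrow> (real \<Rightarrow> real) \<Rightarrow> (real \<Rightarrow> real) \<Rightarrow> bool" where
  "desingularizing \<eta> \<phi> \<phi>' \<longleftrightarrow>
     (\<forall>t. 0 < t \<and> t < \<eta> \<longrightarrow> 0 \<le> \<phi> t \<and> 0 < \<phi>' t) \<and>
     (\<forall>s t. 0 < s \<and> s < \<eta> \<and> 0 < t \<and> t < \<eta> \<longrightarrow> \<phi>' t * (t - s) \<le> \<phi> t - \<phi> s)"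

lemma desingularizingD:
  assumes "desingularizing \<eta> \<phi> \<phi>'"
  shows "0 < t \<Longrightarrow> t < \<eta> \<Longrightarrow> 0 \<le> \<phi> t" "0 < t \<Longrightarrow> t < \<eta> \<Longrightarrow> 0 < \<phi>' t"
    "0 < s \<Longrightarrow> s < \<eta> \<Longrightarrow> 0 < t \<Longrightarrow> t < \<eta> \<Longrightarrow> \<phi>' t * (t - s) \<le> \<phi> t - \<phi> s"
  using assms by (auto simp: desingularizing_def)

text \<open>Add the tangent inequalities at the two points.\<close>

lemma desingularizing_deriv_antimono:
  assumes des: "desingularizing \<eta> \<phi> \<phi>'" and "0 < s" "s \<le> t" "t < \<eta>"
  shows "\<phi>' t \<le> \<phi>' s"
proof (cases "s = t")
  case False
  with assms have st: "0 < t - s" by simp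
  have "\<phi>' t * (t - s) \<le> \<phi> t - \<phi> s" "\<phi>' s * (s - t) \<le> \<phi> s - \<phi> t"
    using desingularizingD(3)[OF des] assms by auto
  then have "\<phi>' t * (t - s) \<le> \<phi>' s * (t - s)" by (simp add: algebra_simps)
  with st show ?thesis by simp
qed simp

lemma desingularizing_add:
  assumes "desingularizing \<eta>1 \<phi>1 \<phi>1'" "desingularizing \<eta>2 \<phi>2 \<phi>2'"
  shows "desingularizing (min \<eta>1 \<eta>2) (\<lambda>t. \<phi>1 t + \<phi>2 t) (\<lambda>t. \<phi>1' t + \<phi>2' t)"
  unfolding desingularizing_def
proof (intro conjI allI impI)
  fix t assume "0 < t \<and> t < min \<eta>1 \<eta>2"
  then show "0 \<le> \<phi>1 t + \<phi>2 t" "0 < \<phi>1' t + \<phi>2' t"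
    using assms[THEN desingularizingD(1), of t] assms[THEN desingularizingD(2), of t] by auto
next
  fix s t assume "0 < s \<and> s < min \<eta>1 \<eta>2 \<and> 0 < t \<and> t < min \<eta>1 \<eta>2"
  then show "(\<phi>1' t + \<phi>2' t) * (t - s) \<le> \<phi>1 t + \<phi>2 t - (\<phi>1 s + \<phi>2 s)"
    using assms[THEN desingularizingD(3), of s t] by (simp add: distrib_right)
qed

lemma desingularizing_sqrt: "desingularizing \<eta> sqrt (\<lambda>t. 1 / (2 * sqrt t))"
  unfolding desingularizing_def
proof (intro conjI allI impI)
  fix s t :: real assume "0 < s \<and> s < \<eta> \<and> 0 < t \<and> t < \<eta>"
  then have st: "0 < s" "0 < t" by auto
  have "(sqrt t - sqrt s) * (2 * sqrt t) = (t - s) + (sqrt t - sqrt s)\<^sup>2"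
    using st by (simp add: power2_eq_square algebra_simps)
  then have "t - s \<le> (sqrt t - sqrt s) * (2 * sqrt t)"
    by simp
  then show "1 / (2 * sqrt t) * (t - s) \<le> sqrt t - sqrt s"
    using st by (simp add: pos_divide_le_eq)
qed auto

text \<open>The bound \<open>b \<le> 1\<close> keeps \<open>b * t\<close> inside the interval.
  Rescaling is used to pass the KL inequality from the objective to the merit value.\<close>

lemma desingularizing_rescale:
  assumes des: "desingularizing \<eta> \<phi> \<phi>'" and "0 < a" "0 < b" "b \<le> 1"
  shows "desingularizing \<eta> (\<lambda>t. a * \<phi> (b * t)) (\<lambda>t. a * b * \<phi>' (b * t))"
  unfolding desingularizing_def
proof (intro conjI allI impI)
  have scaled: "0 < b * t" "b * t < \<eta>" if "0 < t" "t < \<eta>" for t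
  proof -
    show "0 < b * t" using that assms by simp
    have "b * t \<le> 1 * t" using that assms by (intro mult_right_mono) auto
    with that show "b * t < \<eta>" by linarith
  qed
  {
    fix t assume "0 < t \<and> t < \<eta>"
    then show "0 \<le> a * \<phi> (b * t)" "0 < a * b * \<phi>' (b * t)"
      using scaled[of t] desingularizingD[OF des] assms by auto
  }
  fix s t assume "0 < s \<and> s < \<eta> \<and> 0 < t \<and> t < \<eta>"
  then have "\<phi>' (b * t) * (b * t - b * s) \<le> \<phi> (b * t) - \<phi> (b * s)"
    using scaled by (intro desingularizingD(3)[OF des]) auto
  then have "a * (\<phi>' (b * t) * (b * t - b * s)) \<le> a * (\<phi> (b * t) - \<phi> (b * s))"
    using assms by (intro mult_left_mono) auto
  then show "a * b * \<phi>' (b * t) * (t - s) \<le> a * \<phi> (b * t) - a * \<phi> (b * s)"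
    by (simp add: algebra_simps)
qed

text \<open>One desingularizing function serves all of \<open>V\<close> at the single level
  \<open>c\<close>. Quantifying over subgradients replaces the distance to the subdifferential:
  where that set is empty nothing is imposed, in agreement with the distance \<infinity>.\<close>

definition uniform_KL :: "('a::euclidean_space \<Rightarrow> ereal) \<Rightarrow> real \<Rightarrow> 'a set \<Rightarrow> bool" where
  "uniform_KL f c V \<longleftrightarrow> (\<exists>\<eta> \<phi> \<phi>'. 0 < \<eta> \<and> desingularizing \<eta> \<phi> \<phi>' \<and>
     (\<forall>v\<in>V. \<forall>u\<in>limiting_subdiff f v. \<forall>r. f v = ereal r \<and> c < r \<and> r < c + \<eta> \<longrightarrow>
        1 \<le> \<phi>' (r - c) * norm u))"

lemma KL_property_imp_uniform_KL:
  assumes KL: "KL_property_at f p" and fp: "f p = ereal c"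
  obtains U where "open U" "p \<in> U" "uniform_KL f c U"
proof -
  from KL obtain \<eta> U \<phi> \<phi>' where \<eta>: "(0::ereal) < \<eta>" and U: "open U" "p \<in> U"
    and conc: "concave_on {t. 0 \<le> t \<and> ereal t < \<eta>} \<phi>"
    and nonneg: "\<And>t. 0 \<le> t \<Longrightarrow> ereal t < \<eta> \<Longrightarrow> 0 \<le> \<phi> t"
    and der: "\<And>t. 0 < t \<Longrightarrow> ereal t < \<eta> \<Longrightarrow> (\<phi> has_real_derivative \<phi>' t) (at t) \<and> 0 < \<phi>' t"
    and ineq: "\<And>x. x \<in> U \<Longrightarrow> f p < f x \<Longrightarrow> f x < f p + \<eta> \<Longrightarrow>
           1 \<le> ereal (\<phi>' (real_of_ereal (f x - f p))) * dist_set 0 (limiting_subdiff f x)"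
    unfolding KL_property_at_def by blast
  \<comment> \<open>The bound \<open>\<eta>\<close> may be \<infinity>, so a finite \<open>e\<close>
    takes its place.\<close>
  have "\<exists>e. 0 < e \<and> ereal e \<le> \<eta>"
    using \<eta> by (cases \<eta>) (auto intro: zero_less_one)
  then obtain e where e: "0 < e" "ereal e \<le> \<eta>" by blast
  have below: "ereal t < \<eta>" if "t < e" for t
    using that e by (meson ereal_less(2) less_ereal.simps(1) less_le_trans)
  have "desingularizing e \<phi> \<phi>'"
    unfolding desingularizing_def
  proof (intro conjI allI impI)
    fix t assume "0 < t \<and> t < e"
    then show "0 \<le> \<phi> t" "0 < \<phi>' t" using nonneg der below by auto
  next
    fix s t assume st: "0 < s \<and> s < e \<and> 0 < t \<and> t < e"
    \<comment> \<open>The endpoint 0 is dropped: the tangent inequality for convex functions asks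
      for an interior point.\<close>
    have "convex_on {0<..<e} (\<lambda>t. - \<phi> t)"
      using conc below unfolding concave_on_def by (auto intro: convex_on_subset)
    moreover have "((\<lambda>t. - \<phi> t) has_real_derivative - \<phi>' t) (at t within {0<..<e})"
      using der[of t] st below by (intro DERIV_minus) (auto intro: has_field_derivative_at_within)
    ultimately have "- \<phi> s - - \<phi> t \<ge> - \<phi>' t * (s - t)"
      using st by (intro convex_on_imp_above_tangent[of "{0<..<e}"]) (auto simp: interior_open)
    then show "\<phi>' t * (t - s) \<le> \<phi> t - \<phi> s" by (simp add: algebra_simps)
  qed
  moreover have "1 \<le> \<phi>' (r - c) * norm u"
    if v: "v \<in> U" "u \<in> limiting_subdiff f v" and r: "f v = ereal r \<and> c < r \<and> r < c + e" for v u r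
  proof -
    have "ereal (r - c) < \<eta>" using r by (intro below) simp
    then have "f v < f p + \<eta>" using r fp by (cases \<eta>) auto
    then have "1 \<le> ereal (\<phi>' (r - c)) * dist_set 0 (limiting_subdiff f v)"
      using ineq[OF v(1)] r fp by simp
    also have "\<dots> \<le> ereal (\<phi>' (r - c)) * ereal (norm u)"
    proof (rule ereal_mult_left_mono)
      show "dist_set 0 (limiting_subdiff f v) \<le> ereal (norm u)"
        unfolding dist_set_def using v(2) by (intro INF_lower2[of u]) auto
      show "0 \<le> ereal (\<phi>' (r - c))"
        using der[of "r - c"] r below[of "r - c"] by (simp add: less_imp_le)
    qed
    finally show ?thesis by (simp add: one_ereal_def)
  qed
  ultimately have "uniform_KL f c U"
    unfolding uniform_KL_def using e by blast
  with U that show thesis by blast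
qed

lemma uniform_KL_empty: "uniform_KL f c {}"
  unfolding uniform_KL_def using desingularizing_sqrt[of 1]
  by (intro exI[of _ "1::real"] exI conjI) auto

text \<open>The sum of the two desingularizing functions serves both sets, since the derivative
  added to the one in use is positive.\<close>

lemma uniform_KL_Un:
  assumes "uniform_KL f c V" "uniform_KL f c W"
  shows "uniform_KL f c (V \<union> W)"
proof -
  from assms(1) obtain \<eta>1 \<phi>1 \<phi>1' where 1: "0 < \<eta>1" "desingularizing \<eta>1 \<phi>1 \<phi>1'"
    "\<And>v u r. v \<in> V \<Longrightarrow> u \<in> limiting_subdiff f v \<Longrightarrow> f v = ereal r \<Longrightarrow> c < r \<Longrightarrow> r < c + \<eta>1 \<Longrightarrow>
        1 \<le> \<phi>1' (r - c) * norm u"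
    unfolding uniform_KL_def by blast
  from assms(2) obtain \<eta>2 \<phi>2 \<phi>2' where 2: "0 < \<eta>2" "desingularizing \<eta>2 \<phi>2 \<phi>2'"
    "\<And>v u r. v \<in> W \<Longrightarrow> u \<in> limiting_subdiff f v \<Longrightarrow> f v = ereal r \<Longrightarrow> c < r \<Longrightarrow> r < c + \<eta>2 \<Longrightarrow>
        1 \<le> \<phi>2' (r - c) * norm u"
    unfolding uniform_KL_def by blast
  have "1 \<le> (\<phi>1' (r - c) + \<phi>2' (r - c)) * norm u"
    if v: "v \<in> V \<union> W" "u \<in> limiting_subdiff f v" and r: "f v = ereal r" "c < r" "r < c + min \<eta>1 \<eta>2"
    for v u r
  proof -
    have "0 < \<phi>1' (r - c)" "0 < \<phi>2' (r - c)"
      using desingularizingD(2)[OF 1(2)] desingularizingD(2)[OF 2(2)] r by auto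
    then have "0 \<le> \<phi>1' (r - c) * norm u" "0 \<le> \<phi>2' (r - c) * norm u" by auto
    moreover have "1 \<le> \<phi>1' (r - c) * norm u \<or> 1 \<le> \<phi>2' (r - c) * norm u"
    proof (cases "v \<in> V")
      case True
      with v r 1(3)[of v u r] show ?thesis by simp
    next
      case False
      with v r 2(3)[of v u r] show ?thesis by simp
    qed
    ultimately show ?thesis by (auto simp: distrib_right)
  qed
  then show ?thesis
    unfolding uniform_KL_def using desingularizing_add[OF 1(2) 2(2)] 1(1) 2(1)
    by (intro exI[of _ "min \<eta>1 \<eta>2"] exI conjI) auto
qed

text \<open>Finitely many of the neighbourhoods from the pointwise property cover \<open>K\<close>
  and are merged by \<open>uniform_KL_Un\<close>. This works because \<open>f\<close> is constant on
  \<open>K\<close>, so all of them refer to the same level.\<close>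

lemma compact_uniform_KL:
  assumes K: "compact K" and KL: "\<And>p. p \<in> K \<Longrightarrow> KL_property_at f p \<and> f p = ereal c"
  obtains U where "open U" "K \<subseteq> U" "uniform_KL f c U"
proof -
  define \<C> where "\<C> = {U. open U \<and> uniform_KL f c U}"
  have "K \<subseteq> \<Union>\<C>"
  proof
    fix p assume "p \<in> K"
    with KL obtain U where "open U" "p \<in> U" "uniform_KL f c U"
      using KL_property_imp_uniform_KL by metis
    then show "p \<in> \<Union>\<C>" by (auto simp: \<C>_def)
  qed
  then obtain \<D> where \<D>: "\<D> \<subseteq> \<C>" "finite \<D>" "K \<subseteq> \<Union>\<D>"
    by (rule compactE[OF K]) (auto simp: \<C>_def)
  have "uniform_KL f c (\<Union>\<D>)"
    using \<D>(2,1) by (induction \<D>) (auto simp: uniform_KL_empty \<C>_def intro: uniform_KL_Un)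
  moreover have "open (\<Union>\<D>)" using \<D>(1) by (auto simp: \<C>_def)
  ultimately show thesis using that \<D>(3) by blast
qed

section \<open>Cluster sets of bounded sequences\<close>

lemma cluster_point_subsequence:
  fixes X :: "nat \<Rightarrow> 'a::metric_space"
  assumes "p \<in> (\<Inter>n. closure (X ` {n..}))"
  obtains g where "filterlim g at_top sequentially" "(\<lambda>n. X (g n)) \<longlonglongrightarrow> p"
proof -
  have "\<exists>k\<ge>n. dist (X k) p < inverse (real (Suc n))" for n
  proof -
    have "p \<in> closure (X ` {n..})" using assms by blast
    then show ?thesis
      unfolding closure_approachable by (auto dest!: spec[of _ "inverse (real (Suc n))"])
  qed
  \<comment> \<open>The indices \<open>g n\<close> need not increase strictly; tending to infinity
    is enough for composing limits.\<close>
  then obtain g where g: "\<And>n. g n \<ge> n" "\<And>n. dist (X (g n)) p < inverse (real (Suc n))"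
    by metis
  have "filterlim g at_top sequentially"
    by (rule filterlim_at_top_mono[OF filterlim_ident]) (use g in auto)
  moreover have "(\<lambda>n. X (g n)) \<longlonglongrightarrow> p"
    by (rule metric_tendsto_imp_tendsto[OF LIMSEQ_inverse_real_of_nat])
      (use g(2) in \<open>auto simp: less_imp_le\<close>)
  ultimately show thesis using that by blast
qed

text \<open>Otherwise the closures of the tails, minus \<open>U\<close>, would be nested nonempty
  compact sets with empty intersection.\<close>

lemma eventually_in_nbhd_of_cluster_set:
  fixes X :: "nat \<Rightarrow> 'a::heine_borel"
  assumes bdd: "bounded (range X)" and U: "open U" "(\<Inter>n. closure (X ` {n..})) \<subseteq> U"
  shows "eventually (\<lambda>n. X n \<in> U) sequentially"
proof (rule ccontr)
  assume "\<not> ?thesis"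
  then have freq: "\<exists>k\<ge>n. X k \<notin> U" for n
    by (auto simp: eventually_sequentially)
  let ?F = "\<lambda>n. closure (X ` {n..}) \<inter> - U"
  have "\<Inter>(range ?F) \<noteq> {}"
  proof (rule compact_nest)
    show "compact (?F n)" for n
      using bdd U(1) by (intro compact_Int_closed) (auto simp: compact_closure intro: bounded_subset)
    show "?F n \<noteq> {}" for n
      using freq[of n] closure_subset[of "X ` {n..}"] by fastforce
    show "?F n \<subseteq> ?F m" if "m \<le> n" for m n
    proof -
      have "closure (X ` {n..}) \<subseteq> closure (X ` {m..})"
        using that by (intro closure_mono image_mono) auto
      then show ?thesis by blast
    qed
  qed
  then show False using U(2) by blast
qed

lemma bounded_sequence_uniform_KL:
  fixes X :: "nat \<Rightarrow> 'a::euclidean_space"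
  assumes bdd: "bounded (range X)"
    and lim: "\<And>g p. filterlim g at_top sequentially \<Longrightarrow> (\<lambda>n. X (g n)) \<longlonglongrightarrow> p \<Longrightarrow>
      KL_property_at f p \<and> f p = ereal c"
  obtains U where "uniform_KL f c U" "eventually (\<lambda>n. X n \<in> U) sequentially"
proof -
  let ?K = "\<Inter>n. closure (X ` {n..})"
  have "compact (closure (X ` {0..}))"
    using bdd by (auto simp: compact_closure intro: bounded_subset)
  \<comment> \<open>Intersecting with the closure of the whole range exhibits the cluster set as a
    closed part of a compact set.\<close>
  then have "compact (closure (X ` {0..}) \<inter> ?K)"
    by (intro compact_Int_closed closed_INT) auto
  moreover have "closure (X ` {0..}) \<inter> ?K = ?K"
    by (intro Int_absorb1 INF_lower) simp
  ultimately have "compact ?K" by metis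
  moreover have "KL_property_at f p \<and> f p = ereal c" if "p \<in> ?K" for p
    using that lim by (rule cluster_point_subsequence)
  ultimately obtain U where "open U" "?K \<subseteq> U" "uniform_KL f c U"
    by (rule compact_uniform_KL)
  with that eventually_in_nbhd_of_cluster_set[OF bdd] show thesis by blast
qed

text \<open>
  The objective values \<open>V k\<close> may lie below their limit or far below the merit value \<open>P k\<close>.
  If \<open>V k - c\<close> is at least half of \<open>P k - c\<close>, the KL inequality for \<open>V k\<close> passes to \<open>P k\<close>
  with \<open>t \<mapsto> \<phi> (t / 2)\<close>; otherwise \<open>P k - c\<close> is of quadratic order in \<open>D k + B k\<close>, which is
  the KL inequality for \<open>P k\<close> with a square root.
\<close>

lemma KL_merit_summable:
  fixes P V D B :: "nat \<Rightarrow> real"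
  assumes des: "desingularizing \<eta> \<phi> \<phi>'" and \<eta>: "0 < \<eta>"
    and D: "\<And>k. 0 \<le> D k" and B: "\<And>k. 0 \<le> B k"
    and lim: "P \<longlonglongrightarrow> c" and \<delta>: "0 < \<delta>" and decr: "\<And>k. P (Suc k) + \<delta> * (D k)\<^sup>2 \<le> P k"
    and VP: "\<And>k. V k \<le> P k" and PV: "\<And>k. P k - V k \<le> C1 * (D k + B k)\<^sup>2"
    and C: "0 < C1" "0 < C2" "0 \<le> C3" and \<rho>: "0 \<le> \<rho>" "\<rho> < 1"
    and rec: "\<And>k. B (Suc k) \<le> C3 * D k + \<rho> * B k"
    and KL: "eventually (\<lambda>k. c < V k \<and> V k < c + \<eta> \<longrightarrow> 1 \<le> \<phi>' (V k - c) * (C2 * (D k + B k))) sequentially"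
  shows "summable D \<and> summable B"
proof -
  have step: "P (Suc k) \<le> P k" for k
    using decr[of k] \<delta> by (smt (verit) mult_nonneg_nonneg zero_le_power2)
  then have "decseq P" by (intro decseq_SucI)
  then have Pc: "c \<le> P k" for k using lim by (rule decseq_ge)
  \<comment> \<open>Summability depends on tails only, so it suffices to have the product inequality
    from some index \<open>N\<close> on.\<close>
  have shift: "summable D \<and> summable B"
    if "\<And>k. 0 \<le> G k" "summable G" "\<And>k. (D (k + N))\<^sup>2 \<le> G k * (D (k + N) + B (k + N))" for G N
    using summable_product_recurrence[of "\<lambda>k. B (k + N)" "\<lambda>k. D (k + N)" G \<rho> C3] that D B \<rho> C rec
    by (simp add: summable_iff_shift)
  show ?thesis
  proof (cases "\<exists>N. P N = c")
    \<comment> \<open>If \<open>P\<close> reaches its limit, the descent forces \<open>D\<close> to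
      vanish from there on, and \<open>G\<close> can be 0.\<close>
    case True
    then obtain N where N: "P N = c" by blast
    have "P (k + N) = c" for k
      using decseqD[OF \<open>decseq P\<close>, of N "k + N"] N Pc[of "k + N"] by simp
    then have "\<delta> * (D (k + N))\<^sup>2 \<le> 0" for k
      using decr[of "k + N"] by (metis add_Suc add_le_same_cancel1)
    then have "(D (k + N))\<^sup>2 \<le> 0" for k
      using \<delta> by (simp add: mult_le_0_iff)
    then show ?thesis by (intro shift[of "\<lambda>_. 0" N]) auto
  next
    case False
    define r where "r k = P k - c" for k
    have rpos: "0 < r k" for k using Pc[of k] False unfolding r_def by (metis diff_gt_0_iff_gt less_eq_real_def)
    have "eventually (\<lambda>k. P k < c + \<eta>) sequentially"
      using order_tendstoD(2)[OF lim, of "c + \<eta>"] \<eta> by simp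
    with KL have "eventually (\<lambda>k. P k < c + \<eta> \<and>
        (c < V k \<and> V k < c + \<eta> \<longrightarrow> 1 \<le> \<phi>' (V k - c) * (C2 * (D k + B k)))) sequentially"
      by (rule eventually_elim2) auto
    then obtain N where N: "\<And>k. k \<ge> N \<Longrightarrow> r k < \<eta>"
      "\<And>k. k \<ge> N \<Longrightarrow> c < V k \<Longrightarrow> V k < c + \<eta> \<Longrightarrow> 1 \<le> \<phi>' (V k - c) * (C2 * (D k + B k))"
      unfolding eventually_sequentially r_def by (metis add.commute diff_less_eq)
    \<comment> \<open>The coefficients make the derivative equal to
      \<open>C2 * \<phi>' (t / 2)\<close> plus \<open>sqrt (2 * C1) / sqrt t\<close>, one summand
      for each case of \<open>merit_KL\<close>.\<close>
    define \<Phi> where "\<Phi> t = 2 * C2 * \<phi> (1 / 2 * t) + 2 * sqrt (2 * C1) * sqrt (1 * t)" for t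
    define \<Phi>' where "\<Phi>' t = 2 * C2 * (1 / 2) * \<phi>' (1 / 2 * t)
      + 2 * sqrt (2 * C1) * 1 * (1 / (2 * sqrt (1 * t)))" for t
    have des\<Phi>: "desingularizing \<eta> \<Phi> \<Phi>'"
      using desingularizing_add[OF desingularizing_rescale[OF des, of "2 * C2" "1 / 2"]
        desingularizing_rescale[OF desingularizing_sqrt[of \<eta>], of "2 * sqrt (2 * C1)" 1]] C
      unfolding \<Phi>_def \<Phi>'_def by simp
    have merit_KL: "1 \<le> \<Phi>' (r k) * (D k + B k)" if k: "k \<ge> N" for k
    proof -
      have \<phi>': "0 < \<phi>' (r k / 2)"
        using desingularizingD(2)[OF des, of "r k / 2"] rpos[of k] N(1)[OF k] by simp
      have T: "0 \<le> D k + B k" using D B by simp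
      have split: "\<Phi>' (r k) * (D k + B k)
          = \<phi>' (r k / 2) * (C2 * (D k + B k)) + sqrt (2 * C1) * (D k + B k) / sqrt (r k)"
        by (simp add: \<Phi>'_def field_simps)
      have nonneg: "0 \<le> \<phi>' (r k / 2) * (C2 * (D k + B k))"
        "0 \<le> sqrt (2 * C1) * (D k + B k) / sqrt (r k)"
        using \<phi>' T C rpos[of k] by (auto simp: less_imp_le)
      show ?thesis
      proof (cases "r k / 2 \<le> V k - c")
        case True
        have V: "V k - c \<le> r k" using VP[of k] by (simp add: r_def)
        have "1 \<le> \<phi>' (V k - c) * (C2 * (D k + B k))"
          using True V rpos[of k] N(1)[OF k] by (intro N(2)[OF k]) auto
        also have "\<dots> \<le> \<phi>' (r k / 2) * (C2 * (D k + B k))"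
          using True V rpos[of k] N(1)[OF k] T C
          by (intro mult_right_mono desingularizing_deriv_antimono[OF des]) auto
        finally show ?thesis using split nonneg by simp
      next
        case False
        then have "r k < 2 * C1 * (D k + B k)\<^sup>2"
          using PV[of k] unfolding r_def by simp
        then have "sqrt (r k) < sqrt (2 * C1 * (D k + B k)\<^sup>2)"
          by (rule real_sqrt_less_mono)
        then have "sqrt (r k) < sqrt (2 * C1) * (D k + B k)"
          using T by (simp add: real_sqrt_mult)
        then have "1 \<le> sqrt (2 * C1) * (D k + B k) / sqrt (r k)"
          using rpos[of k] by (simp add: pos_le_divide_eq)
        then show ?thesis using split nonneg by simp
      qed
    qed
    \<comment> \<open>The partial sums of \<open>G\<close> telescope and are bounded because
      \<open>\<Phi>\<close> is nonnegative. The tangent inequality, multiplied by the KL inequality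
      of the merit value, bounds the decrease of \<open>P\<close> by \<open>\<delta> * G k\<close>
      times the increments.\<close>
    define G where "G k = (\<Phi> (r (k + N)) - \<Phi> (r (Suc k + N))) / \<delta>" for k
    have rN: "0 < r (k + N)" "r (k + N) < \<eta>" for k
      using rpos N(1)[of "k + N"] by auto
    have rr: "r (Suc k + N) \<le> r (k + N)" for k
      using step[of "k + N"] by (simp add: r_def)
    have tangent: "\<Phi>' (r (k + N)) * (r (k + N) - r (Suc k + N)) \<le> \<delta> * G k" for k
      using desingularizingD(3)[OF des\<Phi> rN[of "Suc k"] rN[of k]] \<delta> by (simp add: G_def)
    have pos: "0 < \<Phi>' (r (k + N))" for k
      using desingularizingD(2)[OF des\<Phi> rN[of k]] .
    show ?thesis
    proof (rule shift)
      show G0: "0 \<le> G k" for k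
      proof -
        have "0 \<le> \<delta> * G k"
          using tangent[of k] pos[of k] rr[of k] by (smt (verit) mult_nonneg_nonneg)
        then show ?thesis using \<delta> by (simp add: zero_le_mult_iff)
      qed
      show "summable G"
      proof (rule summableI_nonneg_bounded[OF G0])
        fix n
        have "(\<Sum>i<n. G i) = (\<Phi> (r (0 + N)) - \<Phi> (r (n + N))) / \<delta>"
          unfolding G_def sum_divide_distrib[symmetric]
          by (subst sum_lessThan_telescope'[of "\<lambda>k. \<Phi> (r (k + N))"]) simp
        also have "\<dots> \<le> \<Phi> (r (0 + N)) / \<delta>"
          using desingularizingD(1)[OF des\<Phi> rN[of n]] \<delta> by (intro divide_right_mono) auto
        finally show "(\<Sum>i<n. G i) \<le> \<Phi> (r (0 + N)) / \<delta>" .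
      qed
      show "(D (k + N))\<^sup>2 \<le> G k * (D (k + N) + B (k + N))" for k
      proof -
        let ?T = "D (k + N) + B (k + N)"
        have T: "0 \<le> ?T" using D B by simp
        have "\<delta> * (D (k + N))\<^sup>2 \<le> r (k + N) - r (Suc k + N)"
          using decr[of "k + N"] by (simp add: r_def)
        also have "\<dots> \<le> (r (k + N) - r (Suc k + N)) * (\<Phi>' (r (k + N)) * ?T)"
          using merit_KL[of "k + N"] rr[of k] by (simp add: mult_le_cancel_left1)
        also have "\<dots> = \<Phi>' (r (k + N)) * (r (k + N) - r (Suc k + N)) * ?T"
          by simp
        also have "\<dots> \<le> \<delta> * G k * ?T"
          by (intro mult_right_mono tangent T)
        finally show ?thesis using \<delta> by simp
      qed
    qed
  qed
qed

subsection \<open>The forward-backward envelope along the iteration\<close>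

text \<open>The number \<open>c\<close> is meant to be the value of the nonsmooth term at
  \<open>z\<close>. If \<open>z\<close> is a proximal point of the forward step from
  \<open>y\<close>, this is the forward-backward envelope at \<open>y\<close>, the minimum of the
  expression over \<open>z\<close>.\<close>

definition fb_envelope :: "real \<Rightarrow> ('a::real_inner \<Rightarrow> real) \<Rightarrow> ('a \<Rightarrow> 'a) \<Rightarrow> real \<Rightarrow> 'a \<Rightarrow> 'a \<Rightarrow> real" where
  "fb_envelope \<gamma> g dg c y z = g y + c + dg y \<bullet> (z - y) + (norm (z - y))\<^sup>2 / (2 * \<gamma>)"

lemma fb_envelope_ge:
  assumes grad: "\<And>v. GDERIV g v :> dg v" and lip: "L-lipschitz_on UNIV dg"
    and "0 < \<gamma>" "\<gamma> * L \<le> 1"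
  shows "g z + c \<le> fb_envelope \<gamma> g dg c y z"
proof -
  have "L / 2 \<le> 1 / (2 * \<gamma>)"
    using assms(3,4) by (simp add: field_simps)
  then have "L / 2 * (norm (z - y))\<^sup>2 \<le> 1 / (2 * \<gamma>) * (norm (z - y))\<^sup>2"
    by (intro mult_right_mono) auto
  then show ?thesis
    using lipschitz_gradient_upper[OF grad lip, of z y] by (simp add: fb_envelope_def)
qed

lemma fb_envelope_le:
  assumes grad: "\<And>v. GDERIV g v :> dg v" and lip: "L-lipschitz_on UNIV dg"
  shows "fb_envelope \<gamma> g dg c y z \<le> g z + c + (L / 2 + 1 / (2 * \<gamma>)) * (norm (z - y))\<^sup>2"
  using lipschitz_gradient_lower[OF grad lip, of y z] by (simp add: fb_envelope_def distrib_right)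

lemma Prox_forward_step:
  fixes f :: "'a::euclidean_space \<Rightarrow> ereal"
  assumes z: "z \<in> Prox \<gamma> f (y - \<gamma> *\<^sub>R G)" and \<gamma>: "0 < \<gamma>"
    and fz: "f z = ereal c" and fv: "f v = ereal t"
  shows "c + G \<bullet> (z - y) + (norm (z - y))\<^sup>2 / (2 * \<gamma>) \<le> t + G \<bullet> (v - y) + (norm (v - y))\<^sup>2 / (2 * \<gamma>)"
proof -
  \<comment> \<open>Completing the square: the term with \<open>norm G\<close> does not depend on
    \<open>u\<close> and cancels when two points are compared.\<close>
  have *: "1 / (2 * \<gamma>) * (norm (u - (y - \<gamma> *\<^sub>R G)))\<^sup>2
      = (norm (u - y))\<^sup>2 / (2 * \<gamma>) + G \<bullet> (u - y) + \<gamma> / 2 * (norm G)\<^sup>2" for u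
  proof -
    have "(norm (u - (y - \<gamma> *\<^sub>R G)))\<^sup>2 = (norm ((u - y) + \<gamma> *\<^sub>R G))\<^sup>2"
      by (simp add: algebra_simps)
    also have "\<dots> = (norm (u - y))\<^sup>2 + 2 * \<gamma> * (G \<bullet> (u - y)) + \<gamma>\<^sup>2 * (norm G)\<^sup>2"
      unfolding power2_norm_eq_inner inner_add_left inner_add_right
      by (simp add: inner_commute[of "u - y" G] power2_eq_square)
    finally show ?thesis using \<gamma> by (simp add: field_simps power2_eq_square)
  qed
  have "f z + ereal (1 / (2 * \<gamma>) * (norm (z - (y - \<gamma> *\<^sub>R G)))\<^sup>2)
      \<le> f v + ereal (1 / (2 * \<gamma>) * (norm (v - (y - \<gamma> *\<^sub>R G)))\<^sup>2)"
    using z by (auto simp: Prox_def is_arg_min_def not_less)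
  then show ?thesis
    unfolding * fz fv by simp
qed

text \<open>Here \<open>v\<close> competes with the minimizer \<open>z\<close>. With a cluster point
  as \<open>v\<close>, this bounds the limit of the envelopes by the objective value there.\<close>

lemma fb_envelope_le_value:
  fixes f :: "'a::euclidean_space \<Rightarrow> ereal"
  assumes grad: "\<And>v. GDERIV g v :> dg v" and lip: "L-lipschitz_on UNIV dg"
    and z: "z \<in> Prox \<gamma> f (y - \<gamma> *\<^sub>R dg y)" and \<gamma>: "0 < \<gamma>"
    and fz: "f z = ereal c" and fv: "f v = ereal t"
  shows "fb_envelope \<gamma> g dg c y z \<le> g v + t + (L / 2 + 1 / (2 * \<gamma>)) * (norm (v - y))\<^sup>2"
  using Prox_forward_step[OF z \<gamma> fz fv] fb_envelope_le[OF grad lip, of \<gamma> t y v]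
  by (simp add: fb_envelope_def)

text \<open>Minimality of \<open>z\<close> gives \<open>f\<close> a quadratic minorant at
  \<open>z\<close> with slope \<open>- dg y - (1 / \<gamma>) *\<^sub>R (z - y)\<close>, and the
  Lipschitz gradient gives \<open>g\<close> one with slope \<open>dg z\<close>. Their sum is a
  quadratic minorant of \<open>F\<close>.\<close>

lemma forward_backward_subgradient:
  fixes f :: "'a::euclidean_space \<Rightarrow> ereal"
  assumes grad: "\<And>v. GDERIV g v :> dg v" and lip: "L-lipschitz_on UNIV dg"
    and z: "z \<in> Prox \<gamma> f (y - \<gamma> *\<^sub>R dg y)" and \<gamma>: "0 < \<gamma>" and proper: "proper_fun f"
    and F: "\<And>v. F v = f v + ereal (g v)"
  shows "dg z - dg y - (1 / \<gamma>) *\<^sub>R (z - y) \<in> frechet_subdiff F z"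
proof -
  obtain c where c: "f z = ereal c" using Prox_finite[OF proper z] by blast
  show ?thesis
  proof (rule proximal_subgradient_frechet)
    show "F z = ereal (c + g z)" by (simp add: F c)
    fix v
    show "ereal (c + g z + (dg z - dg y - (1 / \<gamma>) *\<^sub>R (z - y)) \<bullet> (v - z)
        - (L / 2 + 1 / (2 * \<gamma>)) * (norm (v - z))\<^sup>2) \<le> F v"
    proof (cases "f v")
      case (real t)
      have "v - y = (v - z) + (z - y)" by simp
      then have vy: "(norm (v - y))\<^sup>2 = (norm (v - z))\<^sup>2 + 2 * ((z - y) \<bullet> (v - z)) + (norm (z - y))\<^sup>2"
        unfolding power2_norm_eq_inner by (simp only: inner_add_left inner_add_right inner_commute)
      have "(norm (v - y))\<^sup>2 / (2 * \<gamma>)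
          = (norm (v - z))\<^sup>2 / (2 * \<gamma>) + (1 / \<gamma>) * ((z - y) \<bullet> (v - z)) + (norm (z - y))\<^sup>2 / (2 * \<gamma>)"
        unfolding vy using \<gamma> by (simp add: field_simps)
      moreover have "dg y \<bullet> (v - y) = dg y \<bullet> (v - z) + dg y \<bullet> (z - y)"
        by (simp add: inner_diff_right)
      moreover have "(dg z - dg y - (1 / \<gamma>) *\<^sub>R (z - y)) \<bullet> (v - z)
          = dg z \<bullet> (v - z) - dg y \<bullet> (v - z) - (1 / \<gamma>) * ((z - y) \<bullet> (v - z))"
        by (simp only: inner_diff_left inner_scaleR_left)
      moreover have "(L / 2 + 1 / (2 * \<gamma>)) * (norm (v - z))\<^sup>2
          = L / 2 * (norm (v - z))\<^sup>2 + (norm (v - z))\<^sup>2 / (2 * \<gamma>)"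
        by (simp add: distrib_right)
      ultimately have "c + g z + (dg z - dg y - (1 / \<gamma>) *\<^sub>R (z - y)) \<bullet> (v - z)
          - (L / 2 + 1 / (2 * \<gamma>)) * (norm (v - z))\<^sup>2 \<le> t + g v"
        using Prox_forward_step[OF z \<gamma> c real] lipschitz_gradient_lower[OF grad lip, of z v]
        by linarith
      then show ?thesis by (simp add: F real)
    next
      case PInf
      then show ?thesis by (simp add: F)
    next
      case MInf
      then show ?thesis using proper by (simp add: proper_fun_def)
    qed
  qed
qed

text \<open>In the application \<open>d\<close>, \<open>e\<close> and \<open>H\<close> are the
  increments of \<open>y\<close>, \<open>\<gamma> *\<^sub>R df1 y\<close> and \<open>dh y\<close>,
  while \<open>a\<close> and \<open>b\<close> are the current and the previous increment of
  \<open>x\<close>. The cross terms are reduced to squares so that \<open>a\<close> and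
  \<open>b\<close> get the same coefficient and telescope.\<close>

lemma DYS_descent_algebra:
  fixes d e a b H :: "'a::real_inner"
  assumes p: "d + e = (1 + \<alpha>) *\<^sub>R a - \<alpha> *\<^sub>R b"
    and H: "norm H \<le> Lh * norm d" and e: "norm e \<le> \<gamma> * L * norm d"
    and \<alpha>: "0 \<le> \<alpha>" "\<alpha> \<le> 1" and \<gamma>: "0 < \<gamma>" and Lh: "0 < Lh"
  shows "(\<gamma> * l + \<gamma> * Lh - 1) * (norm d)\<^sup>2 + 2 * (norm e)\<^sup>2 - 2 * \<alpha> * ((e - d) \<bullet> a)
        + 2 * \<gamma> * (H \<bullet> (e - \<alpha> *\<^sub>R a)) + \<alpha>\<^sup>2 * (1 + \<gamma> * Lh) * (norm a)\<^sup>2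
        + (1 - \<gamma> * l - 2 * \<gamma> * Lh - (2 + \<gamma> * Lh) * (\<gamma>\<^sup>2 * L\<^sup>2 + \<alpha>)) * (norm d)\<^sup>2
      \<le> \<alpha>\<^sup>2 * (1 + \<gamma> * Lh) * (norm b)\<^sup>2"
proof -
  define X A B N where "X = (norm d)\<^sup>2" and "A = (norm a)\<^sup>2" and "B = (norm b)\<^sup>2" and "N = (norm e)\<^sup>2"
  have A0: "0 \<le> A" by (simp add: A_def)
  have da: "2 * (d \<bullet> a) \<le> X + A"
    using inner_ge_zero[of "d - a"]
    by (simp add: X_def A_def power2_norm_eq_inner inner_diff_left inner_diff_right inner_commute)
  have "2 * (a \<bullet> b) \<le> A + B"
    using inner_ge_zero[of "a - b"]
    by (simp add: A_def B_def power2_norm_eq_inner inner_diff_left inner_diff_right inner_commute)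
  then have ab: "\<alpha> * (2 * (a \<bullet> b)) \<le> \<alpha> * (A + B)"
    using \<alpha> by (intro mult_left_mono)
  have "(d + e) \<bullet> a = ((1 + \<alpha>) *\<^sub>R a - \<alpha> *\<^sub>R b) \<bullet> a" by (simp only: p)
  then have pa: "d \<bullet> a + e \<bullet> a = (1 + \<alpha>) * A - \<alpha> * (a \<bullet> b)"
    by (simp add: inner_add_left inner_diff_left A_def power2_norm_eq_inner inner_commute[of b a])
  \<comment> \<open>Eliminating \<open>e \<bullet> a\<close> through \<open>pa\<close> produces the
    negative multiple of \<open>A\<close> that offsets the squares from \<open>da\<close> and
    \<open>ab\<close>.\<close>
  have 1: "- 2 * ((e - d) \<bullet> a) \<le> 2 * X - \<alpha> * A + \<alpha> * B"
    using da ab pa by (simp add: inner_diff_left algebra_simps)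
  have 2: "- 2 * (e \<bullet> a) \<le> X - (1 + \<alpha>) * A + \<alpha> * B"
    using da ab pa by (simp add: algebra_simps)
  have 3: "- 2 * \<alpha> * ((e - d) \<bullet> a) \<le> 2 * \<alpha> * X - \<alpha>\<^sup>2 * A + \<alpha>\<^sup>2 * B"
    using mult_left_mono[OF 1 \<alpha>(1)] by (simp add: algebra_simps power2_eq_square)
  have 4: "(norm (e - \<alpha> *\<^sub>R a))\<^sup>2 \<le> N + \<alpha> * X - \<alpha>\<^sup>2 * A + \<alpha>\<^sup>2 * B"
  proof -
    have "(norm (e - \<alpha> *\<^sub>R a))\<^sup>2 = N + \<alpha> * (- 2 * (e \<bullet> a)) + \<alpha>\<^sup>2 * A"
      unfolding N_def A_def power2_norm_eq_inner
      by (simp add: inner_diff_left inner_diff_right inner_commute power2_eq_square algebra_simps)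
    also have "\<dots> \<le> N + \<alpha> * (X - (1 + \<alpha>) * A + \<alpha> * B) + \<alpha>\<^sup>2 * A"
      using mult_left_mono[OF 2 \<alpha>(1)] by simp
    also have "\<dots> = N + \<alpha> * X - \<alpha> * A + \<alpha>\<^sup>2 * B"
      by (simp add: algebra_simps power2_eq_square)
    finally have "(norm (e - \<alpha> *\<^sub>R a))\<^sup>2 \<le> N + \<alpha> * X - \<alpha> * A + \<alpha>\<^sup>2 * B" .
    \<comment> \<open>Here \<alpha> \<le> 1 enters: replacing \<open>\<alpha> * A\<close> by
      \<open>\<alpha>\<^sup>2 * A\<close> matches the coefficient of \<open>B\<close>.\<close>
    moreover have "\<alpha>\<^sup>2 * A \<le> \<alpha> * A"
      using \<alpha> A0 by (intro mult_right_mono) (auto simp: power2_eq_square mult_left_le)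
    ultimately show ?thesis by simp
  qed
  have 5: "2 * \<gamma> * (H \<bullet> (e - \<alpha> *\<^sub>R a)) \<le> \<gamma> * Lh * (X + (N + \<alpha> * X - \<alpha>\<^sup>2 * A + \<alpha>\<^sup>2 * B))"
  proof -
    let ?n = "norm (e - \<alpha> *\<^sub>R a)"
    have "H \<bullet> (e - \<alpha> *\<^sub>R a) \<le> norm H * ?n" by (rule norm_cauchy_schwarz)
    also have "\<dots> \<le> Lh * norm d * ?n" using H by (intro mult_right_mono) auto
    finally have "2 * (H \<bullet> (e - \<alpha> *\<^sub>R a)) \<le> Lh * (2 * norm d * ?n)" by simp
    also have "\<dots> \<le> Lh * (X + ?n\<^sup>2)"
      using Lh sum_squares_bound[of "norm d" ?n] by (intro mult_left_mono) (auto simp: X_def)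
    also have "\<dots> \<le> Lh * (X + (N + \<alpha> * X - \<alpha>\<^sup>2 * A + \<alpha>\<^sup>2 * B))"
      using Lh 4 by (intro mult_left_mono) auto
    finally have "\<gamma> * (2 * (H \<bullet> (e - \<alpha> *\<^sub>R a)))
        \<le> \<gamma> * (Lh * (X + (N + \<alpha> * X - \<alpha>\<^sup>2 * A + \<alpha>\<^sup>2 * B)))"
      using \<gamma> by (intro mult_left_mono) auto
    then show ?thesis by (simp add: mult.assoc mult.left_commute)
  qed
  have "N \<le> (\<gamma> * L * norm d)\<^sup>2"
    unfolding N_def using e by (intro power_mono) auto
  then have "(2 + \<gamma> * Lh) * N \<le> (2 + \<gamma> * Lh) * (\<gamma>\<^sup>2 * L\<^sup>2 * X)"
    using \<gamma> Lh by (intro mult_left_mono) (auto simp: X_def power_mult_distrib)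
  with 3 5 show ?thesis
    unfolding X_def[symmetric] A_def[symmetric] B_def[symmetric] N_def[symmetric]
    by (simp add: algebra_simps)
qed

text \<open>The old \<open>z\<close> competes with \<open>z'\<close> in the new proximal problem.
  What remains compares smooth quantities at \<open>y\<close> and \<open>y'\<close>, and
  \<open>DYS_descent_algebra\<close> estimates it after multiplication by
  \<open>2 * \<gamma>\<close>.\<close>

lemma DYS_merit_descent:
  fixes f1 h :: "'a::euclidean_space \<Rightarrow> real"
  assumes f1: "\<And>v. GDERIV f1 v :> df1 v" "L-lipschitz_on UNIV df1"
      "convex_on UNIV (\<lambda>v. f1 v + l / 2 * (norm v)\<^sup>2)"
    and h: "\<And>v. GDERIV h v :> dh v" "Lh-lipschitz_on UNIV dh"
    and pos: "0 \<le> \<alpha>" "\<alpha> \<le> 1" "0 < \<gamma>" "0 < Lh"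
    and z': "z' \<in> Prox \<gamma> f2 (y' - \<gamma> *\<^sub>R (df1 y' + dh y'))" "f2 z' = ereal c'" and z: "f2 z = ereal c"
    and residual: "z - y = a - \<alpha> *\<^sub>R b"
    and shift: "(y' - y) + \<gamma> *\<^sub>R (df1 y' - df1 y) = (1 + \<alpha>) *\<^sub>R a - \<alpha> *\<^sub>R b"
  defines "E \<equiv> fb_envelope \<gamma> (\<lambda>v. f1 v + h v) (\<lambda>v. df1 v + dh v)"
  shows "E c' y' z' + \<alpha>\<^sup>2 * (1 + \<gamma> * Lh) / (2 * \<gamma>) * (norm a)\<^sup>2
        + (1 - \<gamma> * l - 2 * \<gamma> * Lh - (2 + \<gamma> * Lh) * (\<gamma>\<^sup>2 * L\<^sup>2 + \<alpha>)) / (2 * \<gamma>) * (norm (y' - y))\<^sup>2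
      \<le> E c y z + \<alpha>\<^sup>2 * (1 + \<gamma> * Lh) / (2 * \<gamma>) * (norm b)\<^sup>2"
proof -
  define d e H where "d = y' - y" and "e = \<gamma> *\<^sub>R (df1 y' - df1 y)" and "H = dh y' - dh y"
  have de: "d + e = (1 + \<alpha>) *\<^sub>R a - \<alpha> *\<^sub>R b"
    using shift by (simp add: d_def e_def)
  have s: "z - y = d + e - \<alpha> *\<^sub>R a"
    unfolding de residual by (simp add: scaleR_add_left)
  have zy': "z - y' = e - \<alpha> *\<^sub>R a"
    using s by (simp add: d_def algebra_simps)
  have nH: "norm H \<le> Lh * norm d"
    using lipschitz_onD[OF h(2), of y' y] by (simp add: H_def d_def dist_norm)
  have "norm (df1 y' - df1 y) \<le> L * norm d"
    using lipschitz_onD[OF f1(2), of y' y] by (simp add: d_def dist_norm)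
  then have ne: "norm e \<le> \<gamma> * L * norm d"
    using pos(3) by (simp add: e_def mult.assoc)
  \<comment> \<open>\<open>f1\<close> is expanded at the new point and \<open>h\<close> at the old
    one; the gradients then combine into \<open>df1 y' - df1 y\<close> paired with
    \<open>z - y\<close> and \<open>H\<close> paired with \<open>z - y'\<close>.\<close>
  have 1: "f1 y' - f1 y \<le> df1 y' \<bullet> d + l / 2 * (norm d)\<^sup>2"
    using weakly_convex_gradient_lower[OF f1(1,3), of y' y]
    by (simp add: d_def inner_diff_right norm_minus_commute)
  have 2: "h y' - h y \<le> dh y \<bullet> d + Lh / 2 * (norm d)\<^sup>2"
    using lipschitz_gradient_upper[OF h, of y' y] by (simp add: d_def)
  have "E c' y' z' - E c y z \<le> (f1 y' - f1 y) + (h y' - h y)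
      + (df1 y' + dh y') \<bullet> (z - y') - (df1 y + dh y) \<bullet> (z - y)
      + ((norm (z - y'))\<^sup>2 - (norm (z - y))\<^sup>2) / (2 * \<gamma>)"
    using Prox_forward_step[OF z'(1) pos(3) z'(2) z]
    by (simp add: E_def fb_envelope_def diff_divide_distrib)
  also have "\<dots> \<le> (df1 y' \<bullet> d + l / 2 * (norm d)\<^sup>2) + (dh y \<bullet> d + Lh / 2 * (norm d)\<^sup>2)
      + (df1 y' + dh y') \<bullet> (z - y') - (df1 y + dh y) \<bullet> (z - y)
      + ((norm (z - y'))\<^sup>2 - (norm (z - y))\<^sup>2) / (2 * \<gamma>)"
    using 1 2 by simp
  also have "\<dots> = (l + Lh) / 2 * (norm d)\<^sup>2 + (df1 y' - df1 y) \<bullet> (z - y) + H \<bullet> (z - y')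
      + ((norm (z - y'))\<^sup>2 - (norm (z - y))\<^sup>2) / (2 * \<gamma>)"
    by (simp add: d_def H_def inner_add_left inner_diff_left inner_diff_right algebra_simps add_divide_distrib)
  finally have bound: "E c' y' z' - E c y z \<le> (l + Lh) / 2 * (norm d)\<^sup>2
      + (df1 y' - df1 y) \<bullet> (z - y) + H \<bullet> (z - y') + ((norm (z - y'))\<^sup>2 - (norm (z - y))\<^sup>2) / (2 * \<gamma>)" .
  have es: "e \<bullet> (z - y) = \<gamma> * ((df1 y' - df1 y) \<bullet> (z - y))"
    by (simp only: e_def inner_scaleR_left)
  have "2 * \<gamma> * (E c' y' z' - E c y z) \<le> 2 * \<gamma> * ((l + Lh) / 2 * (norm d)\<^sup>2
      + (df1 y' - df1 y) \<bullet> (z - y) + H \<bullet> (z - y') + ((norm (z - y'))\<^sup>2 - (norm (z - y))\<^sup>2) / (2 * \<gamma>))"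
    using bound pos(3) by (intro mult_left_mono) auto
  also have "\<dots> = \<gamma> * (l + Lh) * (norm d)\<^sup>2 + 2 * (e \<bullet> (z - y)) + 2 * \<gamma> * (H \<bullet> (z - y'))
      + ((norm (z - y'))\<^sup>2 - (norm (z - y))\<^sup>2)"
    unfolding es using pos(3) by (simp add: field_simps)
  also have "(norm (z - y'))\<^sup>2 - (norm (z - y))\<^sup>2 = (norm d)\<^sup>2 - 2 * (d \<bullet> (z - y))"
  proof -
    have "z - y' = (z - y) - d" by (simp add: d_def)
    then show ?thesis
      unfolding power2_norm_eq_inner
      by (simp only: inner_diff_left[of "z - y" d] inner_diff_right[of _ "z - y" d] inner_commute[of "z - y" d])
  qed
  \<comment> \<open>After substituting the residuals, \<open>(e - d) \<bullet> (d + e)\<close>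
    collapses to \<open>(norm e)\<^sup>2 - (norm d)\<^sup>2\<close>.\<close>
  also have "\<gamma> * (l + Lh) * (norm d)\<^sup>2 + 2 * (e \<bullet> (z - y)) + 2 * \<gamma> * (H \<bullet> (z - y'))
      + ((norm d)\<^sup>2 - 2 * (d \<bullet> (z - y)))
    = (\<gamma> * l + \<gamma> * Lh - 1) * (norm d)\<^sup>2 + 2 * (norm e)\<^sup>2 - 2 * \<alpha> * ((e - d) \<bullet> a)
      + 2 * \<gamma> * (H \<bullet> (e - \<alpha> *\<^sub>R a))"
    unfolding s zy' power2_norm_eq_inner
    by (simp add: inner_add_left inner_add_right inner_diff_left inner_diff_right inner_commute algebra_simps)
  finally have "2 * \<gamma> * (E c' y' z' - E c y z) + \<alpha>\<^sup>2 * (1 + \<gamma> * Lh) * (norm a)\<^sup>2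
        + (1 - \<gamma> * l - 2 * \<gamma> * Lh - (2 + \<gamma> * Lh) * (\<gamma>\<^sup>2 * L\<^sup>2 + \<alpha>)) * (norm d)\<^sup>2
      \<le> \<alpha>\<^sup>2 * (1 + \<gamma> * Lh) * (norm b)\<^sup>2"
    using DYS_descent_algebra[OF de nH ne pos, of l] by linarith
  then have "(2 * \<gamma> * (E c' y' z' - E c y z) + \<alpha>\<^sup>2 * (1 + \<gamma> * Lh) * (norm a)\<^sup>2
        + (1 - \<gamma> * l - 2 * \<gamma> * Lh - (2 + \<gamma> * Lh) * (\<gamma>\<^sup>2 * L\<^sup>2 + \<alpha>)) * (norm d)\<^sup>2) / (2 * \<gamma>)
      \<le> (\<alpha>\<^sup>2 * (1 + \<gamma> * Lh) * (norm b)\<^sup>2) / (2 * \<gamma>)"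
    using pos(3) by (intro divide_right_mono) auto
  then show ?thesis
    using pos(3) unfolding d_def by (simp add: add_divide_distrib)
qed

section \<open>Finite length and convergence of the iterates\<close>

lemma summable_norm_diff_convergent:
  fixes X :: "nat \<Rightarrow> 'a::banach"
  assumes "summable (\<lambda>n. norm (X (Suc n) - X n))"
  shows "convergent X"
proof -
  have "summable (\<lambda>n. X (Suc n) - X n)" using assms by (rule summable_norm_cancel)
  then have "(\<lambda>n. \<Sum>i<n. X (Suc i) - X i) \<longlonglongrightarrow> (\<Sum>n. X (Suc n) - X n)"
    by (rule summable_LIMSEQ)
  then have "(\<lambda>n. X n - X 0 + X 0) \<longlonglongrightarrow> (\<Sum>n. X (Suc n) - X n) + X 0"
    unfolding sum_lessThan_telescope by (intro tendsto_add tendsto_const)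
  then show ?thesis by (auto simp: convergent_def)
qed

theorem theorem3p10:
  fixes f1 h :: "real ^ 'n \<Rightarrow> real"
    and f2 :: "real ^ 'n \<Rightarrow> ereal"
    and df1 dh :: "real ^ 'n \<Rightarrow> real ^ 'n"
    and d2h :: "real ^ 'n \<Rightarrow> (real ^ 'n) \<Rightarrow>\<^sub>L (real ^ 'n)"
    and Lf1 Lh l \<alpha> \<gamma> M :: real
    and w y z x :: "nat \<Rightarrow> real ^ 'n"
  assumes f1_grad: "\<And>v. GDERIV f1 v :> df1 v" and df1_cont: "continuous_on UNIV df1"
    and h_grad: "\<And>v. GDERIV h v :> dh v" and dh_cont: "continuous_on UNIV dh"
    and Lf1_pos: "Lf1 > 0" and df1_lipschitz: "Lf1-lipschitz_on UNIV df1"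
    and Lh_pos: "Lh > 0" and dh_lipschitz: "Lh-lipschitz_on UNIV dh"
    and f2_proper: "proper_fun f2" and f2_closed: "lower_semicont f2"
    and F_bounded_below: "\<exists>m::real. \<forall>v. ereal m \<le> objective f1 f2 h v"
    and f1_weakly_convex: "convex_on UNIV (\<lambda>v. f1 v + l / 2 * (norm v)\<^sup>2)"
    and \<gamma>_range: "0 < \<gamma>" "\<gamma> < 1 / (Lf1 + Lh)"
    and \<alpha>_range: "0 \<le> \<alpha>" "\<alpha> < DYS_Lambda l Lf1 Lh \<gamma>"
    and h_hessian: "\<And>v. (dh has_derivative blinfun_apply (d2h v)) (at v)"
    and d2h_cont: "continuous_on UNIV d2h"
    and M_pos: "M > 0" and d2h_bounded: "\<And>v. norm (d2h v) \<le> M"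
    and iteration: "extrapolated_DYS \<alpha> \<gamma> f1 f2 dh w y z x"
    and iterates_bounded: "bounded ((\<lambda>k. (y k, z k, x k)) ` {1..})"
    and F_KL: "KL_function (objective f1 f2 h)"
  shows "summable (\<lambda>k. norm (y (k + 2) - y (k + 1))) \<and>
         summable (\<lambda>k. norm (z (k + 2) - z (k + 1))) \<and>
         summable (\<lambda>k. norm (x (k + 2) - x (k + 1))) \<and>
         convergent (\<lambda>k. DYS_tuple y z x (k + 1))"
proof -
  define g dg L where "g = (\<lambda>v. f1 v + h v)" and "dg = (\<lambda>v. df1 v + dh v)" and "L = Lf1 + Lh"
  define F where "F = objective f1 f2 h"
  have F: "F v = f2 v + ereal (g v)" for v
    by (cases "f2 v") (auto simp: F_def objective_def g_def)
  have grad: "GDERIV g v :> dg v" for v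
    unfolding g_def dg_def by (intro GDERIV_add f1_grad h_grad)
  have lip: "L-lipschitz_on UNIV dg"
    unfolding dg_def L_def by (intro lipschitz_on_add df1_lipschitz dh_lipschitz)
  have L: "0 < L" using Lf1_pos Lh_pos by (simp add: L_def)
  have \<gamma>L: "\<gamma> * L < 1"
    using \<gamma>_range(2) L by (simp add: L_def[symmetric] pos_less_divide_eq)

  \<comment> \<open>This equals \<open>(2 + \<gamma> * Lh) * (DYS_Lambda l Lf1 Lh \<gamma> -
    \<alpha>) / (2 * \<gamma>)\<close>, so it is positive exactly by the upper bound on
    \<alpha>.\<close>
  define \<delta> where "\<delta> = (1 - \<gamma> * l - 2 * \<gamma> * Lh - (2 + \<gamma> * Lh) * (\<gamma>\<^sup>2 * Lf1\<^sup>2 + \<alpha>)) / (2 * \<gamma>)"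
  have \<gamma>Lh: "0 < 2 + \<gamma> * Lh"
    using \<gamma>_range(1) Lh_pos by (simp add: add_pos_pos)
  have \<alpha>\<Lambda>: "\<gamma>\<^sup>2 * Lf1\<^sup>2 + \<alpha> < (1 - \<gamma> * l - 2 * \<gamma> * Lh) / (2 + \<gamma> * Lh)"
    using \<alpha>_range(2) by (simp add: DYS_Lambda_def)
  have \<delta>: "0 < \<delta>"
    using \<alpha>\<Lambda> \<gamma>Lh \<gamma>_range(1) by (simp add: \<delta>_def pos_less_divide_eq mult.commute)
  \<comment> \<open>The fraction in \<open>DYS_Lambda\<close> is at most 1: its numerator is below 2
    by \<open>- Lf1 \<le> l\<close> and \<open>\<gamma> * Lf1 < 1\<close>, and its denominator
    exceeds 2.\<close>
  have \<alpha>1: "\<alpha> \<le> 1"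
  proof -
    have "- Lf1 \<le> l"
      by (rule weak_convexity_modulus_ge[OF f1_grad df1_lipschitz f1_weakly_convex])
    then have "- (\<gamma> * Lf1) \<le> \<gamma> * l"
      using \<gamma>_range(1) by (metis minus_mult_right mult_left_mono less_imp_le)
    moreover have "\<gamma> * Lf1 < 1"
      using \<gamma>L mult_pos_pos[OF \<gamma>_range(1) Lh_pos] by (simp add: L_def distrib_left)
    moreover have "0 < \<gamma> * Lh" using \<gamma>_range(1) Lh_pos by simp
    ultimately have "1 - \<gamma> * l - 2 * (\<gamma> * Lh) \<le> 2 + \<gamma> * Lh"
      by linarith
    then have "(1 - \<gamma> * l - 2 * \<gamma> * Lh) / (2 + \<gamma> * Lh) \<le> 1"
      using \<gamma>Lh by (simp only: pos_divide_le_eq mult.assoc mult_1)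
    moreover have "0 \<le> \<gamma>\<^sup>2 * Lf1\<^sup>2" by simp
    ultimately show ?thesis using \<alpha>\<Lambda> by linarith
  qed

  \<comment> \<open>The shift lets \<open>w k\<close> produce \<open>Y k\<close> and
    \<open>Z k\<close>. Truncated subtraction gives \<open>A 0 = 0\<close>, the convention for the
    first extrapolation.\<close>
  define Y Z A where "Y = (\<lambda>k. y (Suc k))" and "Z = (\<lambda>k. z (Suc k))" and "A = (\<lambda>k. x k - x (k - 1))"
  have w: "w k = x k + \<alpha> *\<^sub>R A k" and Yprox: "Y k \<in> Prox \<gamma> (\<lambda>v. ereal (f1 v)) (w k)"
    and Zprox': "Z k \<in> Prox \<gamma> f2 (2 *\<^sub>R Y k - \<gamma> *\<^sub>R dh (Y k) - w k)"
    and x: "x (Suc k) = w k + (Z k - Y k)" for k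
    using iteration unfolding extrapolated_DYS_def Y_def Z_def A_def Suc_eq_plus1 by blast+
  have wY: "w k = Y k + \<gamma> *\<^sub>R df1 (Y k)" for k
    by (rule Prox_gradient[OF f1_grad Yprox \<gamma>_range(1)])
  have Zprox: "Z k \<in> Prox \<gamma> f2 (Y k - \<gamma> *\<^sub>R dg (Y k))" for k
  proof -
    have "2 *\<^sub>R Y k - \<gamma> *\<^sub>R dh (Y k) - w k = Y k - \<gamma> *\<^sub>R dg (Y k)"
      by (simp add: wY dg_def scaleR_add_right scaleR_2)
    with Zprox'[of k] show ?thesis by simp
  qed
  have residual: "Z k - Y k = A (Suc k) - \<alpha> *\<^sub>R A k" for k
    using x[of k] w[of k] by (simp add: A_def)
  have shift: "(Y (Suc k) - Y k) + \<gamma> *\<^sub>R (df1 (Y (Suc k)) - df1 (Y k))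
      = (1 + \<alpha>) *\<^sub>R A (Suc k) - \<alpha> *\<^sub>R A k" for k
  proof -
    have "(Y (Suc k) - Y k) + \<gamma> *\<^sub>R (df1 (Y (Suc k)) - df1 (Y k)) = w (Suc k) - w k"
      by (simp add: wY scaleR_diff_right)
    also have "\<dots> = (1 + \<alpha>) *\<^sub>R A (Suc k) - \<alpha> *\<^sub>R A k"
      by (simp add: w A_def scaleR_add_left)
    finally show ?thesis .
  qed
  have "\<exists>r. f2 (Z k) = ereal r" for k
    using Prox_finite[OF f2_proper Zprox[of k]] by blast
  then obtain c where c: "\<And>k. f2 (Z k) = ereal (c k)" by metis

  \<comment> \<open>Merit function and bounds by the increments\<close>
  define D B S where "D = (\<lambda>k. norm (Y (Suc k) - Y k))" and "B = (\<lambda>k. norm (A k))"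
    and "S = (\<lambda>k. norm (Z k - Y k))"
  \<comment> \<open>\<open>V\<close> is the objective at \<open>Z k\<close>, \<open>E\<close> the
    envelope at \<open>Y k\<close> and \<open>P\<close> the merit value; \<open>\<kappa>\<close> is
    the coefficient from \<open>DYS_merit_descent\<close>.\<close>
  define V where "V = (\<lambda>k. g (Z k) + c k)"
  define E where "E = (\<lambda>k. fb_envelope \<gamma> g dg (c k) (Y k) (Z k))"
  define \<kappa> where "\<kappa> = \<alpha>\<^sup>2 * (1 + \<gamma> * Lh) / (2 * \<gamma>)"
  define P where "P = (\<lambda>k. E k + \<kappa> * (B k)\<^sup>2)"
  define C where "C = L / 2 + 1 / (2 * \<gamma>)"
  have FZ: "F (Z k) = ereal (V k)" for k by (simp add: F c V_def add.commute)
  have \<kappa>: "0 \<le> \<kappa>" using \<gamma>_range(1) Lh_pos by (simp add: \<kappa>_def)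
  have C: "0 < C" using L \<gamma>_range(1) by (simp add: C_def add_pos_pos)
  have D0: "0 \<le> D k" and B0: "0 \<le> B k" and S0: "0 \<le> S k" for k
    by (auto simp: D_def B_def S_def)
  have VE: "V k \<le> E k" for k
    unfolding V_def E_def using \<gamma>L \<gamma>_range(1) by (intro fb_envelope_ge[OF grad lip]) auto
  have EP: "E k \<le> P k" for k using \<kappa> by (simp add: P_def)
  have EV: "E k \<le> V k + C * (S k)\<^sup>2" for k
    unfolding V_def E_def C_def S_def by (rule fb_envelope_le[OF grad lip])
  have descent: "P (Suc k) + \<delta> * (D k)\<^sup>2 \<le> P k" for k
    using DYS_merit_descent[OF f1_grad df1_lipschitz f1_weakly_convex h_grad dh_lipschitz
        \<alpha>_range(1) \<alpha>1 \<gamma>_range(1) Lh_pos Zprox[unfolded dg_def, of "Suc k"] c c residual[of k] shift[of k]]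
    by (simp add: P_def E_def g_def dg_def \<kappa>_def \<delta>_def D_def B_def)

  \<comment> \<open>Dividing \<open>shift\<close> by \<open>1 + \<alpha>\<close> turns the weight
    \<alpha> of the old increment into the contraction factor \<open>\<rho>\<close>.
    \<open>K\<close> is large enough to bound the residual \<open>S\<close>.\<close>
  define \<rho> C3 K where "\<rho> = \<alpha> / (1 + \<alpha>)" and "C3 = 1 + \<gamma> * Lf1" and "K = C3 + \<rho> + \<alpha>"
  have \<rho>: "0 \<le> \<rho>" "\<rho> < 1" using \<alpha>_range(1) by (auto simp: \<rho>_def)
  have C3: "0 < C3" using \<gamma>_range(1) Lf1_pos by (simp add: C3_def add_pos_pos)
  have K: "0 < K" using C3 \<rho> \<alpha>_range(1) by (simp add: K_def)
  have rec: "B (Suc k) \<le> C3 * D k + \<rho> * B k" for k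
  proof -
    let ?d = "Y (Suc k) - Y k" and ?e = "\<gamma> *\<^sub>R (df1 (Y (Suc k)) - df1 (Y k))"
    have "norm (df1 (Y (Suc k)) - df1 (Y k)) \<le> Lf1 * D k"
      using lipschitz_onD[OF df1_lipschitz, of "Y (Suc k)" "Y k"] by (simp add: D_def dist_norm)
    then have "norm ?e \<le> \<gamma> * Lf1 * D k"
      using \<gamma>_range(1) by (simp add: mult.assoc)
    moreover have "(1 + \<alpha>) *\<^sub>R A (Suc k) = ?d + ?e + \<alpha> *\<^sub>R A k"
      using shift[of k] by simp
    then have "norm ((1 + \<alpha>) *\<^sub>R A (Suc k)) \<le> norm ?d + norm ?e + norm (\<alpha> *\<^sub>R A k)"
      by (metis norm_triangle_mono norm_triangle_ineq order_refl)
    ultimately have "(1 + \<alpha>) * B (Suc k) \<le> C3 * D k + \<alpha> * B k"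
      using \<alpha>_range(1) by (simp add: B_def D_def C3_def distrib_right)
    then have "B (Suc k) \<le> (C3 * D k + \<alpha> * B k) / (1 + \<alpha>)"
      using \<alpha>_range(1) by (simp add: pos_le_divide_eq mult.commute)
    also have "\<dots> = C3 * D k / (1 + \<alpha>) + \<rho> * B k"
      by (simp add: add_divide_distrib \<rho>_def)
    also have "C3 * D k / (1 + \<alpha>) \<le> C3 * D k"
      using \<alpha>_range(1) mult_nonneg_nonneg[OF less_imp_le[OF C3] D0[of k]]
      by (simp add: pos_divide_le_eq distrib_left)
    finally show ?thesis by simp
  qed
  have SDB: "S k \<le> K * (D k + B k)" for k
  proof -
    have "S k \<le> B (Suc k) + \<alpha> * B k"
      unfolding S_def residual B_def using norm_triangle_ineq4[of "A (Suc k)" "\<alpha> *\<^sub>R A k"] \<alpha>_range(1)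
      by simp
    also have "\<dots> \<le> C3 * D k + (\<rho> + \<alpha>) * B k"
      using rec[of k] by (simp add: distrib_right)
    also have "\<dots> \<le> K * D k + K * B k"
      using D0 B0 \<rho> C3 \<alpha>_range(1) by (intro add_mono mult_right_mono) (auto simp: K_def)
    finally show ?thesis by (simp add: distrib_left)
  qed

  \<comment> \<open>Limits of merit values, increments and residuals\<close>
  obtain m where m: "\<And>v. ereal m \<le> F v" using F_bounded_below by (auto simp: F_def)
  have "decseq P"
    using descent \<delta> by (intro decseq_SucI) (smt (verit) mult_nonneg_nonneg zero_le_power2)
  moreover have "m \<le> P k" for k
    using m[of "Z k"] FZ[of k] VE[of k] EP[of k] by simp
  ultimately obtain cs where P_lim: "P \<longlonglongrightarrow> cs"
    using decseq_convergent by blast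
  have sum_D2: "summable (\<lambda>k. (D k)\<^sup>2)"
  proof (rule summable_comparison_test')
    show "summable (\<lambda>k. (P k - P (Suc k)) / \<delta>)"
      using telescope_summable'[OF P_lim] by (rule summable_divide)
    show "norm ((D k)\<^sup>2) \<le> (P k - P (Suc k)) / \<delta>" for k
      using descent[of k] \<delta> by (simp add: pos_le_divide_eq mult.commute)
  qed
  have sum_B2: "summable (\<lambda>k. (B k)\<^sup>2)"
    using C3 by (intro summable_square_recurrence[OF B0 D0 sum_D2 \<rho> _ rec]) simp
  have null: "X \<longlonglongrightarrow> 0" if "summable (\<lambda>k. (X k)\<^sup>2)" for X :: "nat \<Rightarrow> real"
    using summable_LIMSEQ_zero[OF that] by simp
  have S_lim: "S \<longlonglongrightarrow> 0"
  proof (rule tendsto_sandwich[of "\<lambda>_. 0" _ _ "\<lambda>k. K * (D k + B k)"])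
    have "(\<lambda>k. K * (D k + B k)) \<longlonglongrightarrow> K * (0 + 0)"
      by (intro tendsto_intros null sum_D2 sum_B2)
    then show "(\<lambda>k. K * (D k + B k)) \<longlonglongrightarrow> 0" by simp
  qed (use S0 SDB in auto)
  have E_lim: "E \<longlonglongrightarrow> cs"
  proof -
    have "(\<lambda>k. P k - \<kappa> * (B k)\<^sup>2) \<longlonglongrightarrow> cs - \<kappa> * 0"
      by (intro tendsto_intros P_lim summable_LIMSEQ_zero[OF sum_B2])
    then show ?thesis by (simp add: P_def)
  qed
  have V_lim: "V \<longlonglongrightarrow> cs"
  proof (rule tendsto_sandwich[of "\<lambda>k. E k - C * (S k)\<^sup>2" _ _ E])
    have "(\<lambda>k. E k - C * (S k)\<^sup>2) \<longlonglongrightarrow> cs - C * 0\<^sup>2"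
      by (intro tendsto_intros E_lim S_lim)
    then show "(\<lambda>k. E k - C * (S k)\<^sup>2) \<longlonglongrightarrow> cs" by simp
    show "\<forall>\<^sub>F k in sequentially. E k - C * (S k)\<^sup>2 \<le> V k"
      using EV by (simp add: algebra_simps)
  qed (use VE E_lim in auto)

  \<comment> \<open>Vanishing subgradients and cluster points\<close>
  define U where "U = (\<lambda>k. dg (Z k) - dg (Y k) - (1 / \<gamma>) *\<^sub>R (Z k - Y k))"
  have U: "U k \<in> frechet_subdiff F (Z k)" for k
    unfolding U_def by (rule forward_backward_subgradient[OF grad lip Zprox \<gamma>_range(1) f2_proper F])
  have U_le: "norm (U k) \<le> (L + 1 / \<gamma>) * S k" for k
  proof -
    have "norm (dg (Z k) - dg (Y k)) \<le> L * S k"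
      using lipschitz_onD[OF lip, of "Z k" "Y k"] by (simp add: S_def dist_norm)
    moreover have "norm ((1 / \<gamma>) *\<^sub>R (Z k - Y k)) = 1 / \<gamma> * S k"
      using \<gamma>_range(1) by (simp add: S_def)
    ultimately show ?thesis
      unfolding U_def distrib_right by (intro norm_triangle_le_diff) simp
  qed
  have U_lim: "U \<longlonglongrightarrow> 0"
  proof (rule Lim_null_comparison)
    show "(\<lambda>k. (L + 1 / \<gamma>) * S k) \<longlonglongrightarrow> 0"
      using tendsto_mult_left[OF S_lim, of "L + 1 / \<gamma>"] by simp
  qed (use U_le in auto)

  have cluster: "KL_property_at F p \<and> F p = ereal cs"
    if r: "filterlim r at_top sequentially" and Zp: "(\<lambda>n. Z (r n)) \<longlonglongrightarrow> p" for r p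
  proof -
    have FZ_lim: "(\<lambda>n. F (Z (r n))) \<longlonglongrightarrow> ereal cs"
      unfolding FZ by (intro tendsto_ereal filterlim_compose[OF V_lim r])
    have "lower_semicont F" using F_KL by (simp add: KL_function_def F_def)
    then have le: "F p \<le> ereal cs" using Zp FZ_lim by (rule lower_semicont_le_lim)
    then obtain t where t: "f2 p = ereal t"
      using f2_proper by (cases "f2 p") (auto simp: F proper_fun_def)
    have "(\<lambda>n. Z (r n) - Y (r n)) \<longlonglongrightarrow> 0"
      using filterlim_compose[OF S_lim r] by (simp add: S_def tendsto_norm_zero_iff)
    from tendsto_diff[OF Zp this] have Yp: "(\<lambda>n. Y (r n)) \<longlonglongrightarrow> p" by simp
    \<comment> \<open>Lower semicontinuity only gives that \<open>F p\<close> is at most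
      \<open>cs\<close>; the converse follows by letting \<open>p\<close> compete with
      \<open>Z (r n)\<close> and passing to the limit.\<close>
    have "cs \<le> g p + t + C * (norm (p - p))\<^sup>2"
    proof (rule LIMSEQ_le)
      show "(\<lambda>n. E (r n)) \<longlonglongrightarrow> cs" by (rule filterlim_compose[OF E_lim r])
      show "(\<lambda>n. g p + t + C * (norm (p - Y (r n)))\<^sup>2) \<longlonglongrightarrow> g p + t + C * (norm (p - p))\<^sup>2"
        by (intro tendsto_intros Yp)
      show "\<exists>N. \<forall>n\<ge>N. E (r n) \<le> g p + t + C * (norm (p - Y (r n)))\<^sup>2"
        unfolding E_def C_def
        by (intro exI allI impI fb_envelope_le_value[OF grad lip Zprox \<gamma>_range(1) c t])
    qed
    with le have Fp: "F p = ereal cs" by (simp add: F t)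
    have "0 \<in> limiting_subdiff F p"
      unfolding limiting_subdiff_def mem_Collect_eq
    proof (intro conjI exI)
      show "p \<in> dom_fun F" by (simp add: dom_fun_def Fp)
      show "(\<lambda>n. F (Z (r n))) \<longlonglongrightarrow> F p" using FZ_lim by (simp add: Fp)
      show "(\<lambda>n. U (r n)) \<longlonglongrightarrow> 0" by (rule filterlim_compose[OF U_lim r])
    qed (use Zp U in auto)
    then have "p \<in> dom_subdiff F" by (auto simp: dom_subdiff_def)
    with F_KL Fp show ?thesis by (simp add: KL_function_def F_def)
  qed
  have "bounded ((fst \<circ> snd) ` (\<lambda>k. (y k, z k, x k)) ` {1..})"
    unfolding image_comp[symmetric] by (intro bounded_fst bounded_snd iterates_bounded)
  then have "bounded (range Z)"
    by (rule bounded_subset) (auto simp: Z_def image_image)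
  then obtain W where W: "uniform_KL F cs W" "\<forall>\<^sub>F n in sequentially. Z n \<in> W"
    using bounded_sequence_uniform_KL cluster by blast
  from W(1) obtain \<eta> \<phi> \<phi>' where \<eta>: "0 < \<eta>" and des: "desingularizing \<eta> \<phi> \<phi>'"
    and KL: "\<And>v u r. v \<in> W \<Longrightarrow> u \<in> limiting_subdiff F v \<Longrightarrow> F v = ereal r \<Longrightarrow> cs < r \<Longrightarrow> r < cs + \<eta> \<Longrightarrow>
        1 \<le> \<phi>' (r - cs) * norm u"
    unfolding uniform_KL_def by blast

  \<comment> \<open>Summability of the increments\<close>
  have sums: "summable D \<and> summable B"
  proof (rule KL_merit_summable[OF des \<eta> D0 B0 P_lim \<delta> descent])
    show "V k \<le> P k" for k using VE[of k] EP[of k] by simp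
    \<comment> \<open>\<open>C * K\<^sup>2\<close> comes from the gap between envelope and
      objective, \<open>\<kappa>\<close> from the increment term of the merit value.\<close>
    show "P k - V k \<le> (C * K\<^sup>2 + \<kappa>) * (D k + B k)\<^sup>2" for k
    proof -
      have "(S k)\<^sup>2 \<le> (K * (D k + B k))\<^sup>2"
        using SDB S0 by (intro power_mono)
      then have "C * (S k)\<^sup>2 \<le> C * K\<^sup>2 * (D k + B k)\<^sup>2"
        using C by (simp add: power_mult_distrib mult.assoc)
      moreover have "\<kappa> * (B k)\<^sup>2 \<le> \<kappa> * (D k + B k)\<^sup>2"
        using \<kappa> D0 B0 by (intro mult_left_mono power_mono) auto
      ultimately show ?thesis
        using EV[of k] by (simp add: P_def distrib_right)
    qed
    show "0 < C * K\<^sup>2 + \<kappa>" using C K \<kappa> by (simp add: add_pos_nonneg)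
    show "0 < (L + 1 / \<gamma>) * K" using L \<gamma>_range(1) K by (simp add: add_pos_pos)
    show "\<forall>\<^sub>F k in sequentially. cs < V k \<and> V k < cs + \<eta> \<longrightarrow>
        1 \<le> \<phi>' (V k - cs) * ((L + 1 / \<gamma>) * K * (D k + B k))"
      using W(2)
    proof eventually_elim
      case (elim k)
      show ?case
      proof
        assume V: "cs < V k \<and> V k < cs + \<eta>"
        then have "1 \<le> \<phi>' (V k - cs) * norm (U k)"
          using KL[OF elim _ FZ] U[of k] frechet_subset_limiting[of F "Z k"] by auto
        also have "\<dots> \<le> \<phi>' (V k - cs) * ((L + 1 / \<gamma>) * K * (D k + B k))"
        proof (rule mult_left_mono)
          have "(L + 1 / \<gamma>) * S k \<le> (L + 1 / \<gamma>) * (K * (D k + B k))"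
            using L \<gamma>_range(1) SDB by (intro mult_left_mono) auto
          with U_le[of k] show "norm (U k) \<le> (L + 1 / \<gamma>) * K * (D k + B k)"
            by (simp add: mult.assoc)
          show "0 \<le> \<phi>' (V k - cs)"
            using desingularizingD(2)[OF des, of "V k - cs"] V by simp
        qed
        finally show "1 \<le> \<phi>' (V k - cs) * ((L + 1 / \<gamma>) * K * (D k + B k))" .
      qed
    qed
    show "B (Suc k) \<le> C3 * D k + \<rho> * B k" for k by (rule rec)
  qed (use C3 \<rho> in auto)

  \<comment> \<open>Finite length and convergence of the tuple\<close>
  have sum_y: "summable (\<lambda>k. norm (y (Suc (Suc k)) - y (Suc k)))"
    using sums by (simp add: D_def Y_def)
  \<comment> \<open>\<open>B k\<close> is the norm of \<open>x k - x (k - 1)\<close>, so the series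
    is that of \<open>B\<close> shifted by one.\<close>
  have sum_x: "summable (\<lambda>k. norm (x (Suc k) - x k))"
    using sums summable_Suc_iff[of B] by (simp add: B_def A_def)
  have sum_S: "summable S"
    by (rule summable_comparison_test'[of "\<lambda>k. K * (D k + B k)"])
      (use sums SDB S0 in \<open>auto intro!: summable_mult summable_add\<close>)
  have sum_z: "summable (\<lambda>k. norm (z (Suc (Suc k)) - z (Suc k)))"
  proof (rule summable_comparison_test')
    show "summable (\<lambda>k. D k + S (Suc k) + S k)"
      using sums sum_S by (intro summable_add) (auto simp: summable_Suc_iff)
    fix k
    have "Z (Suc k) - Z k = (Y (Suc k) - Y k) + (Z (Suc k) - Y (Suc k)) - (Z k - Y k)" by simp
    then have "norm (Z (Suc k) - Z k) \<le> D k + S (Suc k) + S k"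
      unfolding D_def S_def by (metis norm_triangle_le_diff norm_triangle_ineq add_right_mono)
    then show "norm (norm (z (Suc (Suc k)) - z (Suc k))) \<le> D k + S (Suc k) + S k"
      by (simp add: Z_def)
  qed
  obtain xs where xs: "x \<longlonglongrightarrow> xs"
    using summable_norm_diff_convergent[OF sum_x] by (auto simp: convergent_def)
  obtain ys where ys: "(\<lambda>k. y (Suc k)) \<longlonglongrightarrow> ys"
    using summable_norm_diff_convergent[OF sum_y] by (auto simp: convergent_def)
  obtain zs where zs: "(\<lambda>k. z (Suc k)) \<longlonglongrightarrow> zs"
    using summable_norm_diff_convergent[OF sum_z] by (auto simp: convergent_def)
  \<comment> \<open>Passing to \<open>Suc k\<close> removes the truncated subtraction.\<close>
  have "(\<lambda>k. x (k - 1)) \<longlonglongrightarrow> xs"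
    by (rule LIMSEQ_imp_Suc) (simp add: xs)
  then have "(\<lambda>k. (y (Suc k), z (Suc k), x (Suc k), x k, x (k - 1))) \<longlonglongrightarrow> (ys, zs, xs, xs, xs)"
    using xs by (intro tendsto_Pair ys zs LIMSEQ_Suc)
  then have "convergent (\<lambda>k. DYS_tuple y z x (k + 1))"
    unfolding convergent_def by (intro exI[of _ "(ys, zs, xs, xs, xs)"]) (simp add: DYS_tuple_def)
  with sum_y sum_z sum_x show ?thesis
    by (simp add: summable_Suc_iff[of "\<lambda>k. norm (x (Suc k) - x k)"])
qed

end
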